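(* Let $\Omega\subset\mathbb{R}$ be a compact interval, and suppose that the carrier density $g_0:\Omega\to\mathbb{R}_+$ and the kernel $K:\Omega^2\to\mathbb{R}_+$ are continuous and bounded away from $0$, and that $P_{g_0}$ is a compact operator on $L_2(\Omega)$. Suppose the data-generating density is of the form $$\mu_1,\ldots,\mu_n\sim g_\tau^{(n)}(\mu)=g_0(\mu)\exp\Big[\frac{\tau(\mu)}{\sqrt n}-\psi\Big(\frac{\tau}{\sqrt n}\Big)\Big]$$ for some square-integrable function $\tau$ satisfying $\int_\Omega\tau^2(\mu)g_0(\mu)\,d\mu\le C^2$, and let $f_\tau^{(n)}(x)=\int_\Omega K(\mu,x)g_\tau^{(n)}(\mu)\,d\mu$. Then for every $p\geq 1$ there exists another tilting function $\tau^{(p,* )}$ in the span of the most favorable $p$-dimensional family $\Gamma_p(g_0)$, $$\tau^{(p,* )}=\sum_{j=1}^p\gamma_j^*\,T_j(\mu),$$ such that $$\lim_{n\to\infty}n\,D_{KL}\Big(f_\tau^{(n)},\,f^{(n)}_{\tau^{(p,* )}}\Big)\le\frac12\,C^2\,\lambda_{p+2}(P_{g_0}),$$ where $\lambda_{p+2}(P_{g_0})$ denotes the $(p+2)$-nd eigenvalue of $P_{g_0}$.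
   Context: Given $\mu$, the observation $X\in\Omega$ has density $x\mapsto K(\mu,x)$ on $\Omega$ (so $\int_\Omega K(\mu,x)\,dx=1$). With $f_0(x)=\int_\Omega K(\mu,x)g_0(\mu)\,d\mu$, $P_{g_0}$ is the integral operator on $L_2(\Omega)$ with kernel $$P_{g_0}(\mu_1,\mu_2)=\int_\Omega\sqrt{g_0(\mu_1)}\,K(\mu_1,x)\,f_0^{-1}(x)\,K(\mu_2,x)\,\sqrt{g_0(\mu_2)}\,dx.$$ Its eigenvalues $\lambda_1\ge\lambda_2\ge\cdots$ are listed in decreasing order with multiplicity, with orthonormal eigenfunctions $\zeta_1,\zeta_2,\ldots$; $\zeta_1=\sqrt{g_0}$ with $\lambda_1=1$. The most favorable $p$-dimensional family $\Gamma_p(g_0)$ has statistics $T_j(\mu)=\zeta_{j+1}(\mu)/\sqrt{g_0(\mu)}$, $j=1,\ldots,p$. $\psi(u)=\log\int_\Omega g_0(\mu)e^{u(\mu)}\,d\mu$ is the log-normalizing constant (the density $g_\tau^{(n)}$ is understood to be well defined). $D_{KL}(f,f')=\int f\log(f/f')$. *)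

theory Defs
  imports "HOL-Probability.Probability"
begin

(* L_2(Omega) is represented by functions; elements are identified almost everywhere. *)

definition L2 :: "real set \<Rightarrow> (real \<Rightarrow> real) set" where
  "L2 \<Omega> = {h \<in> borel_measurable (lebesgue_on \<Omega>). integrable (lebesgue_on \<Omega>) (\<lambda>x. (h x)\<^sup>2)}"

definition inner_L2 :: "real set \<Rightarrow> (real \<Rightarrow> real) \<Rightarrow> (real \<Rightarrow> real) \<Rightarrow> real" where
  "inner_L2 \<Omega> g h = (\<integral>x. g x * h x \<partial>lebesgue_on \<Omega>)"

definition norm_L2 :: "real set \<Rightarrow> (real \<Rightarrow> real) \<Rightarrow> real" where
  "norm_L2 \<Omega> h = sqrt (inner_L2 \<Omega> h h)"

(* The integral operator with kernel k. *)
definition integral_op ::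
    "real set \<Rightarrow> (real \<Rightarrow> real \<Rightarrow> real) \<Rightarrow> (real \<Rightarrow> real) \<Rightarrow> (real \<Rightarrow> real)" where
  "integral_op \<Omega> k h = (\<lambda>x. \<integral>y. k x y * h y \<partial>lebesgue_on \<Omega>)"

(* Sequential form of compactness, for linear T such as integral operators:
   images of bounded sequences have norm-convergent subsequences. *)
definition compact_op_L2 ::
    "real set \<Rightarrow> ((real \<Rightarrow> real) \<Rightarrow> (real \<Rightarrow> real)) \<Rightarrow> bool" where
  "compact_op_L2 \<Omega> T \<longleftrightarrow>
     (\<forall>h \<in> L2 \<Omega>. T h \<in> L2 \<Omega>) \<and>
     (\<forall>(h :: nat \<Rightarrow> real \<Rightarrow> real) B. (\<forall>n. h n \<in> L2 \<Omega> \<and> norm_L2 \<Omega> (h n) \<le> B) \<longrightarrow>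
        (\<exists>r \<phi>. strict_mono (r :: nat \<Rightarrow> nat) \<and> \<phi> \<in> L2 \<Omega> \<and>
           (\<lambda>n. norm_L2 \<Omega> (\<lambda>x. T (h (r n)) x - \<phi> x)) \<longlonglongrightarrow> 0))"

definition eigenpair_L2 ::
    "real set \<Rightarrow> ((real \<Rightarrow> real) \<Rightarrow> (real \<Rightarrow> real)) \<Rightarrow> real \<Rightarrow> (real \<Rightarrow> real) \<Rightarrow> bool" where
  "eigenpair_L2 \<Omega> T \<kappa> h \<longleftrightarrow> h \<in> L2 \<Omega> \<and> (AE x in lebesgue_on \<Omega>. T h x = \<kappa> * h x)"

(* lam 1 \<ge> lam 2 \<ge> ... are the eigenvalues of a compact positive semidefinite T, listed with
   multiplicity, with orthonormal eigenfunctions z 1, z 2, ...; index 0 is unused.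
   The last conjunct says that no non-zero eigenvalue, and none of its multiplicity, is omitted.
   Nothing is required of the kernel of T: if T has infinitely many positive eigenvalues, a
   decreasing list never reaches 0; if it has finitely many, the list continues with zeros. *)
definition eigen_listing ::
    "real set \<Rightarrow> ((real \<Rightarrow> real) \<Rightarrow> (real \<Rightarrow> real)) \<Rightarrow> (nat \<Rightarrow> real) \<Rightarrow> (nat \<Rightarrow> real \<Rightarrow> real) \<Rightarrow> bool" where
  "eigen_listing \<Omega> T lam z \<longleftrightarrow>
     (\<forall>k\<ge>1. eigenpair_L2 \<Omega> T (lam k) (z k)) \<and>
     (\<forall>j\<ge>1. \<forall>k\<ge>1. inner_L2 \<Omega> (z j) (z k) = (if j = k then 1 else 0)) \<and>
     (\<forall>j\<ge>1. \<forall>k\<ge>j. lam k \<le> lam j) \<and>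
     (\<forall>\<kappa> h. \<kappa> \<noteq> 0 \<and> eigenpair_L2 \<Omega> T \<kappa> h \<and> (\<forall>k\<ge>1. inner_L2 \<Omega> h (z k) = 0)
        \<longrightarrow> (AE x in lebesgue_on \<Omega>. h x = 0))"

definition marginal ::
    "real set \<Rightarrow> (real \<Rightarrow> real \<Rightarrow> real) \<Rightarrow> (real \<Rightarrow> real) \<Rightarrow> (real \<Rightarrow> real)" where
  "marginal \<Omega> K g = (\<lambda>x. \<integral>\<mu>. K \<mu> x * g \<mu> \<partial>lebesgue_on \<Omega>)"

definition P_kernel ::
    "real set \<Rightarrow> (real \<Rightarrow> real \<Rightarrow> real) \<Rightarrow> (real \<Rightarrow> real) \<Rightarrow> real \<Rightarrow> real \<Rightarrow> real" where
  "P_kernel \<Omega> K g0 \<mu>1 \<mu>2 =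
     (\<integral>x. sqrt (g0 \<mu>1) * K \<mu>1 x * inverse (marginal \<Omega> K g0 x) * K \<mu>2 x * sqrt (g0 \<mu>2)
        \<partial>lebesgue_on \<Omega>)"

definition P_op ::
    "real set \<Rightarrow> (real \<Rightarrow> real \<Rightarrow> real) \<Rightarrow> (real \<Rightarrow> real) \<Rightarrow> (real \<Rightarrow> real) \<Rightarrow> (real \<Rightarrow> real)" where
  "P_op \<Omega> K g0 = integral_op \<Omega> (P_kernel \<Omega> K g0)"

(* Guards against the default values of undefined integrals: without it, psi and the tilted
   density below carry no meaning. *)
definition tilt_ok :: "real set \<Rightarrow> (real \<Rightarrow> real) \<Rightarrow> (real \<Rightarrow> real) \<Rightarrow> bool" where
  "tilt_ok \<Omega> g0 u \<longleftrightarrow> integrable (lebesgue_on \<Omega>) (\<lambda>\<mu>. g0 \<mu> * exp (u \<mu>))"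

definition psi :: "real set \<Rightarrow> (real \<Rightarrow> real) \<Rightarrow> (real \<Rightarrow> real) \<Rightarrow> real" where
  "psi \<Omega> g0 u = ln (\<integral>\<mu>. g0 \<mu> * exp (u \<mu>) \<partial>lebesgue_on \<Omega>)"

definition local_tilt ::
    "real set \<Rightarrow> (real \<Rightarrow> real) \<Rightarrow> (real \<Rightarrow> real) \<Rightarrow> nat \<Rightarrow> (real \<Rightarrow> real)" where
  "local_tilt \<Omega> g0 \<tau> n =
     (\<lambda>\<mu>. g0 \<mu> * exp (\<tau> \<mu> / sqrt n - psi \<Omega> g0 (\<lambda>\<nu>. \<tau> \<nu> / sqrt n)))"

definition favorable_stat ::
    "(real \<Rightarrow> real) \<Rightarrow> (nat \<Rightarrow> real \<Rightarrow> real) \<Rightarrow> nat \<Rightarrow> real \<Rightarrow> real" where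
  "favorable_stat g0 z j \<mu> = z (Suc j) \<mu> / sqrt (g0 \<mu>)"

definition D_KL :: "real set \<Rightarrow> (real \<Rightarrow> real) \<Rightarrow> (real \<Rightarrow> real) \<Rightarrow> real" where
  "D_KL \<Omega> f f' = (\<integral>x. f x * ln (f x / f' x) \<partial>lebesgue_on \<Omega>)"

lemma D_KL_eq_KL_divergence:
  assumes "\<Omega> \<in> lmeasurable"
    and [measurable]: "f \<in> borel_measurable (lebesgue_on \<Omega>)" "f' \<in> borel_measurable (lebesgue_on \<Omega>)"
    and pos: "\<And>x. x \<in> \<Omega> \<Longrightarrow> f x > 0" "\<And>x. x \<in> \<Omega> \<Longrightarrow> f' x > 0"
  shows "D_KL \<Omega> f f' =
    KL_divergence (exp 1) (density (lebesgue_on \<Omega>) f') (density (lebesgue_on \<Omega>) f)"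
proof -
  interpret finite_measure "lebesgue_on \<Omega>"
    using assms(1) by (rule finite_measure_lebesgue_on)
  have sp: "AE x in lebesgue_on \<Omega>. x \<in> \<Omega>"
    by (rule AE_I2) simp
  have "KL_divergence (exp 1) (density (lebesgue_on \<Omega>) f') (density (lebesgue_on \<Omega>) f)
      = (\<integral>x. f x * log (exp 1) (f x / f' x) \<partial>lebesgue_on \<Omega>)"
  proof (rule KL_density_density)
    show "AE x in lebesgue_on \<Omega>. f' x = 0 \<longrightarrow> f x = 0"
      using sp by (rule AE_mp) (rule AE_I2, use pos(2) in force)
    show "AE x in lebesgue_on \<Omega>. 0 \<le> f x"
      using sp by (rule AE_mp) (rule AE_I2, use pos(1) less_imp_le in blast)
    show "AE x in lebesgue_on \<Omega>. 0 \<le> f' x"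
      using sp by (rule AE_mp) (rule AE_I2, use pos(2) less_imp_le in blast)
  qed (use assms(2,3) in simp_all)
  then show ?thesis
    by (simp add: D_KL_def log_def)
qed

end

theory Submission
  imports Defs "HOL-Real_Asymp.Real_Asymp"
begin

text \<open>
  Write \<open>s\<close> for the square root of \<open>g0\<close> and \<open>f0\<close> for the marginal of \<open>g0\<close>.  Everything rests on the
  operator \<open>A h x = (\<integral> K \<mu> x * s \<mu> * h \<mu> d\<mu>) / sqrt (f0 x)\<close>: a perturbation \<open>g0 * (1 + u / sqrt n)\<close>
  of the mixing density, with \<open>u\<close> centred under \<open>g0\<close>, perturbs the marginal by
  \<open>sqrt f0 * A (s * u) / sqrt n\<close>, and \<open>P\<close> is the Gram operator of \<open>A\<close>, that is
  \<open>\<langle>g, P h\<rangle> = \<langle>A g, A h\<rangle>\<close>.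

  \<^item> Divergence.  The divergence is half the chi-squared distance to second order, so \<open>n * D_KL\<close>
    between the two tilted marginals tends to \<open>\<langle>A w, A w\<rangle> / 2\<close>, where \<open>w\<close> is the difference of the
    two centred tilts times \<open>s\<close> (\<open>local_KL_limit\<close>).  Both passages to the limit are dominated: inside
    the mixture, \<open>sqrt n * (exp (\<tau> / sqrt n) - 1)\<close> lies between \<open>\<tau>\<close> and its own value at one
    fixed \<open>n\<close>, by convexity of \<open>exp\<close> (\<open>exp_slope_moments\<close>); outside, the marginals are uniformly
    close to \<open>f0\<close>, which is bounded away from 0 (\<open>scaled_KL_limit\<close>).

  \<^item> Top eigenvalue.  \<open>P s = s\<close>, and the lower bound on \<open>K\<close> gives a spectral gap below 1 on the
    orthogonal complement of \<open>s\<close> (\<open>spectral_gap\<close>).  So the first listed eigenfunction is \<open>s\<close> up to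
    sign, and centring a tilt is the projection that removes its first eigencomponent
    (\<open>top_eigenpair\<close>).

  \<^item> Choice of \<open>\<gamma>\<close>.  The coefficients of \<open>s * \<tau>\<close> along \<open>z 2\<close>, ..., \<open>z (p + 1)\<close> make \<open>w\<close>
    orthogonal to the first \<open>p + 1\<close> eigenfunctions, and then \<open>\<langle>A w, A w\<rangle> \<le> lam (p + 2) * \<langle>w, w\<rangle>\<close>
    (\<open>rayleigh_bound\<close>), while \<open>\<langle>w, w\<rangle> \<le> C\<^sup>2\<close> by Bessel.  An eigenfunction with eigenvalue 0 may
    be unbounded, and then its exponential tilts need not be integrable; its coefficient is therefore
    put to 0, which costs nothing because \<open>A\<close> annihilates it.  Eigenfunctions with non-zero
    eigenvalue are bounded, being proportional to values of \<open>P\<close>.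
\<close>

section \<open>Square-integrable functions as a semi-inner-product space\<close>

text \<open>Functions are not identified almost everywhere, so \<open>inner_L2\<close> is only positive semidefinite, and
  approximations are measured by the squared seminorm \<open>\<langle>f, f\<rangle>\<close>.\<close>

locale finite_L2 =
  fixes \<Omega> :: "real set"
  assumes lmeasurable: "\<Omega> \<in> lmeasurable"
begin

abbreviation "M \<equiv> lebesgue_on \<Omega>"
abbreviation ip ("\<langle>_, _\<rangle>") where "ip \<equiv> inner_L2 \<Omega>"

sublocale finite_measure M
  using lmeasurable by (rule finite_measure_lebesgue_on)

sublocale pair_sigma_finite M M ..

lemma AE_Omega: "AE x in M. x \<in> \<Omega>"
  by (rule AE_I2) simp

lemma L2_measurable: "h \<in> L2 \<Omega> \<Longrightarrow> h \<in> borel_measurable M"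
  by (simp add: L2_def)

lemma L2_integrable_mult:
  assumes "f \<in> L2 \<Omega>" "g \<in> L2 \<Omega>"
  shows "integrable M (\<lambda>x. f x * g x)"
proof (rule Bochner_Integration.integrable_bound)
  show "integrable M (\<lambda>x. (f x)\<^sup>2 + (g x)\<^sup>2)"
    using assms by (auto simp: L2_def)
  have "\<bar>u * v\<bar> \<le> u\<^sup>2 + v\<^sup>2" for u v :: real
  proof -
    have "2 * (\<bar>u\<bar> * \<bar>v\<bar>) \<le> u\<^sup>2 + v\<^sup>2" "0 \<le> \<bar>u\<bar> * \<bar>v\<bar>"
      using sum_squares_bound[of "\<bar>u\<bar>" "\<bar>v\<bar>"] by simp_all
    then show ?thesis by (simp only: abs_mult)
  qed
  then show "AE x in M. norm (f x * g x) \<le> norm ((f x)\<^sup>2 + (g x)\<^sup>2)"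
    by auto
qed (use assms in \<open>auto simp: L2_def\<close>)

lemma L2_bounded:
  assumes [measurable]: "f \<in> borel_measurable M" and "AE x in M. \<bar>f x\<bar> \<le> B"
  shows "f \<in> L2 \<Omega>"
proof -
  have "integrable M (\<lambda>x. (f x)\<^sup>2)"
    by (rule integrable_const_bound[of _ "B\<^sup>2"])
      (use assms(2) in \<open>auto simp flip: abs_le_square_iff intro: order_trans\<close>)
  then show ?thesis
    by (simp add: L2_def)
qed

lemma L2_const: "(\<lambda>_. c) \<in> L2 \<Omega>"
  by (rule L2_bounded[of _ "\<bar>c\<bar>"]) auto

lemma L2_integrable: "f \<in> L2 \<Omega> \<Longrightarrow> integrable M f"
  using L2_integrable_mult[OF _ L2_const[of 1]] by simp

lemma L2_diff:
  assumes "f \<in> L2 \<Omega>" "g \<in> L2 \<Omega>"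
  shows "(\<lambda>x. f x - c * g x) \<in> L2 \<Omega>"
proof -
  have [measurable]: "f \<in> borel_measurable M" "g \<in> borel_measurable M"
    using assms by (auto intro: L2_measurable)
  have "(\<lambda>x. (f x - c * g x)\<^sup>2) = (\<lambda>x. f x * f x - 2 * c * (f x * g x) + c\<^sup>2 * (g x * g x))"
    by (simp add: fun_eq_iff power2_eq_square algebra_simps)
  moreover have "integrable M \<dots>"
    using assms by (intro Bochner_Integration.integrable_add Bochner_Integration.integrable_diff
        integrable_mult_right L2_integrable_mult)
  ultimately show ?thesis
    by (simp add: L2_def)
qed

lemma L2_scale: "f \<in> L2 \<Omega> \<Longrightarrow> (\<lambda>x. c * f x) \<in> L2 \<Omega>"
  using L2_diff[OF L2_const[of 0], of f "-c"] by simp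

lemma L2_sum:
  assumes "finite S" "\<And>k. k \<in> S \<Longrightarrow> f k \<in> L2 \<Omega>"
  shows "(\<lambda>x. \<Sum>k\<in>S. c k * f k x) \<in> L2 \<Omega>"
  using assms
proof (induction S)
  case empty
  show ?case using L2_const[of 0] by simp
next
  case (insert k S)
  then show ?case
    using L2_diff[of "\<lambda>x. \<Sum>k\<in>S. c k * f k x" "f k" "- c k"] by (simp add: add.commute)
qed

lemma inner_commute: "\<langle>f, g\<rangle> = \<langle>g, f\<rangle>"
  by (simp add: inner_L2_def mult.commute)

lemma inner_diff_left:
  assumes "f \<in> L2 \<Omega>" "g \<in> L2 \<Omega>" "h \<in> L2 \<Omega>"
  shows "\<langle>\<lambda>x. f x - c * g x, h\<rangle> = \<langle>f, h\<rangle> - c * \<langle>g, h\<rangle>"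
proof -
  have "\<langle>\<lambda>x. f x - c * g x, h\<rangle> = (\<integral>x. f x * h x - c * (g x * h x) \<partial>M)"
    by (simp add: inner_L2_def algebra_simps)
  also have "\<dots> = \<langle>f, h\<rangle> - c * \<langle>g, h\<rangle>"
    using assms by (simp add: inner_L2_def L2_integrable_mult)
  finally show ?thesis .
qed

lemma inner_diff_right:
  assumes "f \<in> L2 \<Omega>" "g \<in> L2 \<Omega>" "h \<in> L2 \<Omega>"
  shows "\<langle>h, \<lambda>x. f x - c * g x\<rangle> = \<langle>h, f\<rangle> - c * \<langle>h, g\<rangle>"
  using inner_diff_left[OF assms] by (simp add: inner_commute)

lemma inner_scale_left: "\<langle>\<lambda>x. c * f x, h\<rangle> = c * \<langle>f, h\<rangle>"
  by (simp add: inner_L2_def mult.assoc)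

lemma inner_scale_right: "\<langle>h, \<lambda>x. c * f x\<rangle> = c * \<langle>h, f\<rangle>"
  using inner_scale_left by (simp add: inner_commute)

lemma inner_sum_left:
  assumes "\<And>k. k \<in> S \<Longrightarrow> f k \<in> L2 \<Omega>" "h \<in> L2 \<Omega>"
  shows "\<langle>\<lambda>x. \<Sum>k\<in>S. c k * f k x, h\<rangle> = (\<Sum>k\<in>S. c k * \<langle>f k, h\<rangle>)"
proof -
  have "\<langle>\<lambda>x. \<Sum>k\<in>S. c k * f k x, h\<rangle> = (\<integral>x. (\<Sum>k\<in>S. c k * (f k x * h x)) \<partial>M)"
    by (simp add: inner_L2_def sum_distrib_right mult.assoc)
  also have "\<dots> = (\<Sum>k\<in>S. c k * \<langle>f k, h\<rangle>)"
    using assms by (simp add: inner_L2_def L2_integrable_mult Bochner_Integration.integral_sum)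
  finally show ?thesis .
qed

lemma inner_nonneg: "0 \<le> \<langle>f, f\<rangle>"
  by (simp add: inner_L2_def)

lemma inner_eq_0_iff:
  assumes "f \<in> L2 \<Omega>"
  shows "\<langle>f, f\<rangle> = 0 \<longleftrightarrow> (AE x in M. f x = 0)"
  using integral_nonneg_eq_0_iff_AE[OF L2_integrable_mult[OF assms assms]]
  by (simp add: inner_L2_def)

lemma inner_cong_AE:
  assumes "AE x in M. f x = f' x" "AE x in M. g x = g' x"
    and "f \<in> L2 \<Omega>" "f' \<in> L2 \<Omega>" "g \<in> L2 \<Omega>" "g' \<in> L2 \<Omega>"
  shows "\<langle>f, g\<rangle> = \<langle>f', g'\<rangle>"
  unfolding inner_L2_def
proof (rule integral_cong_AE)
  show "AE x in M. f x * g x = f' x * g' x"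
    using assms(1,2) by eventually_elim simp
qed (use assms(3-6) in \<open>auto intro!: borel_measurable_times dest: L2_measurable\<close>)

lemma norm_diff_sq:
  assumes "f \<in> L2 \<Omega>" "g \<in> L2 \<Omega>"
  shows "\<langle>\<lambda>x. f x - c * g x, \<lambda>x. f x - c * g x\<rangle> = \<langle>f, f\<rangle> - 2 * c * \<langle>f, g\<rangle> + c\<^sup>2 * \<langle>g, g\<rangle>"
  using assms L2_diff[OF assms, of c]
  by (simp add: inner_diff_left inner_diff_right inner_commute[of g f] power2_eq_square algebra_simps)

lemma Cauchy_Schwarz:
  assumes "f \<in> L2 \<Omega>" "g \<in> L2 \<Omega>"
  shows "\<langle>f, g\<rangle>\<^sup>2 \<le> \<langle>f, f\<rangle> * \<langle>g, g\<rangle>"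
proof -
  have quadratic: "0 \<le> \<langle>f, f\<rangle> - 2 * c * \<langle>f, g\<rangle> + c\<^sup>2 * \<langle>g, g\<rangle>" for c
    using inner_nonneg[of "\<lambda>x. f x - c * g x"] norm_diff_sq[OF assms, of c] by simp
  show ?thesis
  proof (cases "\<langle>g, g\<rangle> = 0")
    case True
    have "\<langle>f, g\<rangle> = 0"
    proof (rule ccontr)
      assume "\<langle>f, g\<rangle> \<noteq> 0"
      then show False
        using quadratic[of "(\<langle>f, f\<rangle> + 1) / (2 * \<langle>f, g\<rangle>)"] True by simp
    qed
    then show ?thesis using True by simp
  next
    case False
    then have "\<langle>g, g\<rangle> > 0" using inner_nonneg[of g] by linarith
    then show ?thesis
      using quadratic[of "\<langle>f, g\<rangle> / \<langle>g, g\<rangle>"] by (simp add: field_simps power2_eq_square)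
  qed
qed

text \<open>This form of the triangle inequality avoids square roots; the constant 2 is harmless because it is
  only used for sequences that tend to 0.\<close>

lemma norm_triangle_sq:
  assumes "f \<in> L2 \<Omega>" "g \<in> L2 \<Omega>" "h \<in> L2 \<Omega>"
  shows "\<langle>\<lambda>x. f x - h x, \<lambda>x. f x - h x\<rangle>
    \<le> 2 * \<langle>\<lambda>x. f x - g x, \<lambda>x. f x - g x\<rangle> + 2 * \<langle>\<lambda>x. g x - h x, \<lambda>x. g x - h x\<rangle>"
proof -
  define u v where "u = (\<lambda>x. f x - 1 * g x)" and "v = (\<lambda>x. g x - 1 * h x)"
  have uv: "u \<in> L2 \<Omega>" "v \<in> L2 \<Omega>"
    using assms by (auto simp only: u_def v_def intro: L2_diff)
  have "(\<lambda>x. f x - h x) = (\<lambda>x. u x - (-1) * v x)"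
    by (simp add: u_def v_def fun_eq_iff)
  then have "\<langle>\<lambda>x. f x - h x, \<lambda>x. f x - h x\<rangle> = \<langle>u, u\<rangle> + 2 * \<langle>u, v\<rangle> + \<langle>v, v\<rangle>"
    using norm_diff_sq[OF uv, of "-1"] by simp
  moreover have "0 \<le> \<langle>u, u\<rangle> - 2 * \<langle>u, v\<rangle> + \<langle>v, v\<rangle>"
    using norm_diff_sq[OF uv, of 1] inner_nonneg[of "\<lambda>x. u x - 1 * v x"] by simp
  ultimately show ?thesis
    by (simp add: u_def v_def)
qed

lemma Bessel_remainder:
  assumes h: "h \<in> L2 \<Omega>" and S: "finite S" and e: "\<And>k. k \<in> S \<Longrightarrow> e k \<in> L2 \<Omega>"
    and on: "\<And>j k. j \<in> S \<Longrightarrow> k \<in> S \<Longrightarrow> \<langle>e j, e k\<rangle> = (if j = k then 1 else 0)"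
  defines "w \<equiv> \<lambda>x. h x - (\<Sum>k\<in>S. \<langle>h, e k\<rangle> * e k x)"
  shows "w \<in> L2 \<Omega>" "\<And>k. k \<in> S \<Longrightarrow> \<langle>w, e k\<rangle> = 0" "\<langle>w, w\<rangle> \<le> \<langle>h, h\<rangle>"
proof -
  define y where "y = (\<lambda>x. \<Sum>k\<in>S. \<langle>h, e k\<rangle> * e k x)"
  have y: "y \<in> L2 \<Omega>"
    unfolding y_def using S e by (rule L2_sum)
  have w: "w = (\<lambda>x. h x - 1 * y x)"
    by (simp add: w_def y_def)
  show w_L2: "w \<in> L2 \<Omega>"
    unfolding w using h y by (rule L2_diff)
  show orth: "\<langle>w, e k\<rangle> = 0" if "k \<in> S" for k
  proof -
    have "\<langle>y, e k\<rangle> = (\<Sum>j\<in>S. \<langle>h, e j\<rangle> * \<langle>e j, e k\<rangle>)"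
      unfolding y_def using e that by (intro inner_sum_left)
    also have "\<dots> = (\<Sum>j\<in>S. if j = k then \<langle>h, e j\<rangle> else 0)"
      using that on by (intro sum.cong) auto
    also have "\<dots> = \<langle>h, e k\<rangle>"
      using S that by simp
    finally show ?thesis
      unfolding w using h y e[OF that] by (simp add: inner_diff_left[of _ _ _ 1, simplified])
  qed
  have "\<langle>w, y\<rangle> = 0"
    using orth inner_sum_left[of S e w "\<lambda>k. \<langle>h, e k\<rangle>"] e w_L2
    by (simp add: y_def inner_commute)
  moreover have "h = (\<lambda>x. w x - (-1) * y x)"
    by (simp add: w)
  ultimately have "\<langle>h, h\<rangle> = \<langle>w, w\<rangle> + \<langle>y, y\<rangle>"
    using norm_diff_sq[OF w_L2 y, of "-1"] by simp
  then show "\<langle>w, w\<rangle> \<le> \<langle>h, h\<rangle>"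
    using inner_nonneg[of y] by simp
qed

lemma orthogonal_limit:
  assumes f: "f \<in> L2 \<Omega>" and g: "\<And>n. g n \<in> L2 \<Omega>"
    and lim: "(\<lambda>n. \<langle>\<lambda>x. f x - g n x, \<lambda>x. f x - g n x\<rangle>) \<longlonglongrightarrow> 0"
    and e: "e \<in> L2 \<Omega>" "\<And>n. \<langle>g n, e\<rangle> = 0"
  shows "\<langle>f, e\<rangle> = 0"
proof -
  have "\<langle>f, e\<rangle>\<^sup>2 \<le> \<langle>\<lambda>x. f x - g n x, \<lambda>x. f x - g n x\<rangle> * \<langle>e, e\<rangle>" for n
  proof -
    have "\<langle>\<lambda>x. f x - g n x, e\<rangle> = \<langle>f, e\<rangle>"
      using inner_diff_left[OF f g e(1), of 1 n] e(2) by simp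
    then show ?thesis
      using Cauchy_Schwarz[OF _ e(1), of "\<lambda>x. f x - g n x"] L2_diff[OF f g, of 1 n] by simp
  qed
  moreover have "(\<lambda>n. \<langle>\<lambda>x. f x - g n x, \<lambda>x. f x - g n x\<rangle> * \<langle>e, e\<rangle>) \<longlonglongrightarrow> 0 * \<langle>e, e\<rangle>"
    by (intro tendsto_mult lim tendsto_const)
  ultimately have "\<langle>f, e\<rangle>\<^sup>2 \<le> 0 * \<langle>e, e\<rangle>"
    by (intro LIMSEQ_le_const) auto
  then show ?thesis by simp
qed

definition perp :: "nat set \<Rightarrow> (nat \<Rightarrow> real \<Rightarrow> real) \<Rightarrow> (real \<Rightarrow> real) set" where
  "perp S e = {h \<in> L2 \<Omega>. \<forall>k\<in>S. \<langle>h, e k\<rangle> = 0}"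

end

section \<open>Integral operators with a Gram kernel\<close>

text \<open>The operator \<open>P\<close> below is the composition of the adjoint of \<open>A\<close> with \<open>A\<close>.  Symmetry, positivity
  and boundedness of \<open>P\<close> all come from this factorisation.  The kernel of \<open>P\<close> is a parameter of
  its own, so that the operator of the mixture model is literally an instance although its kernel is
  written differently.\<close>

locale gram_kernel = finite_L2 +
  fixes k k2 :: "real \<Rightarrow> real \<Rightarrow> real" and D :: real
  assumes kernel_measurable: "(\<lambda>(x, y). k x y) \<in> borel_measurable (M \<Otimes>\<^sub>M M)"
    and kernel_bound: "\<And>x y. x \<in> \<Omega> \<Longrightarrow> y \<in> \<Omega> \<Longrightarrow> \<bar>k x y\<bar> \<le> D"
    and gram: "\<And>y y'. y \<in> \<Omega> \<Longrightarrow> y' \<in> \<Omega> \<Longrightarrow> k2 y y' = (\<integral>x. k x y * k x y' \<partial>M)"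
begin

abbreviation "A \<equiv> integral_op \<Omega> k"
abbreviation "P \<equiv> integral_op \<Omega> k2"

lemma kernel_measurable' [measurable (raw)]:
  assumes "f \<in> measurable N M" "g \<in> measurable N M"
  shows "(\<lambda>w. k (f w) (g w)) \<in> borel_measurable N"
  using measurable_compose[OF measurable_Pair[OF assms] kernel_measurable] by simp

lemma kernel_section_L2:
  assumes "x \<in> \<Omega>" shows "k x \<in> L2 \<Omega>" "(\<lambda>y. k y x) \<in> L2 \<Omega>"
proof -
  have [measurable]: "(\<lambda>y. x) \<in> measurable M M" using assms by simp
  show "k x \<in> L2 \<Omega>" "(\<lambda>y. k y x) \<in> L2 \<Omega>"
    by (rule L2_bounded[of _ D], measurable, use kernel_bound assms in auto)+
qed

lemma op_eq_inner: "A h x = \<langle>k x, h\<rangle>"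
  by (simp add: integral_op_def inner_L2_def)

lemma op_bound:
  assumes "h \<in> L2 \<Omega>" "x \<in> \<Omega>"
  shows "\<bar>A h x\<bar> \<le> D * (\<integral>y. \<bar>h y\<bar> \<partial>M)"
proof -
  have "\<bar>A h x\<bar> \<le> (\<integral>y. \<bar>k x y * h y\<bar> \<partial>M)"
    unfolding integral_op_def by (rule integral_abs_bound)
  also have "\<dots> \<le> (\<integral>y. D * \<bar>h y\<bar> \<partial>M)"
  proof (rule integral_mono)
    show "integrable M (\<lambda>y. \<bar>k x y * h y\<bar>)"
      using kernel_section_L2(1)[OF assms(2)] assms(1) by (intro integrable_abs L2_integrable_mult)
    show "integrable M (\<lambda>y. D * \<bar>h y\<bar>)"
      using L2_integrable[OF assms(1)] by (intro integrable_mult_right integrable_abs)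
  qed (use kernel_bound assms in \<open>auto simp: abs_mult intro: mult_right_mono\<close>)
  finally show ?thesis by simp
qed

lemma op_measurable [measurable]:
  assumes [measurable]: "h \<in> borel_measurable M"
  shows "A h \<in> borel_measurable M"
  unfolding integral_op_def by measurable

lemma op_L2:
  assumes "h \<in> L2 \<Omega>" shows "A h \<in> L2 \<Omega>"
  by (rule L2_bounded[OF op_measurable[OF L2_measurable[OF assms]]])
    (use op_bound[OF assms] in \<open>auto intro!: AE_I2\<close>)

lemma op_diff:
  assumes "f \<in> L2 \<Omega>" "g \<in> L2 \<Omega>" "x \<in> \<Omega>"
  shows "A (\<lambda>y. f y - c * g y) x = A f x - c * A g x"
  using assms kernel_section_L2 by (simp add: op_eq_inner inner_diff_right)

lemma op_scale:
  assumes "h \<in> L2 \<Omega>" "x \<in> \<Omega>" shows "A (\<lambda>y. c * h y) x = c * A h x"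
  using assms kernel_section_L2 by (simp add: op_eq_inner inner_scale_right)

lemma op_cong_AE:
  assumes "AE y in M. f y = g y" "f \<in> L2 \<Omega>" "g \<in> L2 \<Omega>" "x \<in> \<Omega>"
  shows "A f x = A g x"
  unfolding op_eq_inner using assms by (intro inner_cong_AE kernel_section_L2) auto

text \<open>The hypothesis of Fubini's theorem for the two interchanges below, where the bounded function \<open>u\<close> is
  a column of the kernel or a value of \<open>A\<close>.\<close>

lemma triple_integrable:
  assumes [measurable]: "u \<in> borel_measurable M" and u: "\<And>x. x \<in> \<Omega> \<Longrightarrow> \<bar>u x\<bar> \<le> B"
    and h: "h \<in> L2 \<Omega>"
  shows "integrable (M \<Otimes>\<^sub>M M) (\<lambda>(x, y). u x * k x y * h y)"
proof -
  have [measurable]: "h \<in> borel_measurable M" using h by (rule L2_measurable)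
  have "integrable (M \<Otimes>\<^sub>M M) (\<lambda>(x, y). 1 * h y)"
    by (rule Fubini_integrable) (use L2_integrable[OF h] in auto)
  then have "integrable (M \<Otimes>\<^sub>M M) (\<lambda>z. \<bar>B\<bar> * \<bar>D\<bar> * (case z of (x, y) \<Rightarrow> 1 * h y))"
    by (rule integrable_mult_right)
  then show ?thesis
  proof (rule Bochner_Integration.integrable_bound)
    show "AE z in M \<Otimes>\<^sub>M M. norm (case z of (x, y) \<Rightarrow> u x * k x y * h y)
        \<le> norm (\<bar>B\<bar> * \<bar>D\<bar> * (case z of (x, y) \<Rightarrow> 1 * h y))"
    proof (rule AE_I2, clarsimp simp: space_pair_measure abs_mult)
      fix x y assume "x \<in> \<Omega>" "y \<in> \<Omega>"
      then have "\<bar>u x\<bar> \<le> \<bar>B\<bar>" "\<bar>k x y\<bar> \<le> \<bar>D\<bar>"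
        using u[of x] kernel_bound[of x y] by auto
      then show "\<bar>u x\<bar> * \<bar>k x y\<bar> * \<bar>h y\<bar> \<le> \<bar>B\<bar> * \<bar>D\<bar> * \<bar>h y\<bar>"
        by (intro mult_mono) auto
    qed
  qed measurable
qed

lemma gram_op_eq:
  assumes h: "h \<in> L2 \<Omega>" and y: "y \<in> \<Omega>"
  shows "P h y = (\<integral>x. k x y * A h x \<partial>M)"
proof -
  have [measurable]: "(\<lambda>y'. y) \<in> measurable M M" using y by simp
  have i: "integrable (M \<Otimes>\<^sub>M M) (\<lambda>(x, y'). k x y * k x y' * h y')"
    by (rule triple_integrable[where B = D]) (use kernel_bound y h in auto)
  have "P h y = (\<integral>y'. (\<integral>x. k x y * k x y' * h y' \<partial>M) \<partial>M)"
    unfolding integral_op_def using y by (intro Bochner_Integration.integral_cong) (auto simp: gram)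
  also have "\<dots> = (\<integral>x. (\<integral>y'. k x y * k x y' * h y' \<partial>M) \<partial>M)"
    using Fubini_integral[OF i] by simp
  also have "\<dots> = (\<integral>x. k x y * A h x \<partial>M)"
    by (simp add: integral_op_def mult.assoc)
  finally show ?thesis .
qed

lemma gram_op_bound:
  assumes "h \<in> L2 \<Omega>" "y \<in> \<Omega>"
  shows "\<bar>P h y\<bar> \<le> D * (\<integral>x. \<bar>A h x\<bar> \<partial>M)"
proof -
  have "\<bar>P h y\<bar> \<le> (\<integral>x. \<bar>k x y * A h x\<bar> \<partial>M)"
    unfolding gram_op_eq[OF assms] by (rule integral_abs_bound)
  also have "\<dots> \<le> (\<integral>x. D * \<bar>A h x\<bar> \<partial>M)"
  proof (rule integral_mono)
    show "integrable M (\<lambda>x. \<bar>k x y * A h x\<bar>)"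
      using kernel_section_L2(2)[OF assms(2)] op_L2[OF assms(1)]
      by (intro integrable_abs L2_integrable_mult)
    show "integrable M (\<lambda>x. D * \<bar>A h x\<bar>)"
      using L2_integrable[OF op_L2[OF assms(1)]] by (intro integrable_mult_right integrable_abs)
  qed (use kernel_bound assms in \<open>auto simp: abs_mult intro: mult_right_mono\<close>)
  finally show ?thesis by simp
qed

lemma gram_op_L2:
  assumes h: "h \<in> L2 \<Omega>" shows "P h \<in> L2 \<Omega>"
proof (rule L2_bounded)
  have [measurable]: "h \<in> borel_measurable M" using h by (rule L2_measurable)
  have "(\<lambda>y. \<integral>x. k x y * A h x \<partial>M) \<in> borel_measurable M"
    by measurable
  moreover have "P h \<in> borel_measurable M \<longleftrightarrow> (\<lambda>y. \<integral>x. k x y * A h x \<partial>M) \<in> borel_measurable M"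
    by (rule measurable_cong) (simp add: gram_op_eq[OF h])
  ultimately show "P h \<in> borel_measurable M" by simp
qed (use gram_op_bound[OF h] in \<open>auto intro!: AE_I2\<close>)

lemma gram_op_diff:
  assumes "f \<in> L2 \<Omega>" "g \<in> L2 \<Omega>" "y \<in> \<Omega>"
  shows "P (\<lambda>x. f x - c * g x) y = P f y - c * P g y"
proof -
  have "P (\<lambda>x. f x - c * g x) y = \<langle>\<lambda>x. k x y, A (\<lambda>x. f x - c * g x)\<rangle>"
    using gram_op_eq[OF L2_diff[OF assms(1,2)] assms(3)] by (simp add: inner_L2_def)
  also have "\<dots> = \<langle>\<lambda>x. k x y, \<lambda>x. A f x - c * A g x\<rangle>"
    unfolding inner_L2_def using assms by (intro Bochner_Integration.integral_cong) (auto simp: op_diff)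
  also have "\<dots> = P f y - c * P g y"
    using assms kernel_section_L2(2)[OF assms(3)]
    by (simp add: inner_diff_right op_L2 gram_op_eq flip: inner_L2_def)
  finally show ?thesis .
qed

lemma inner_gram_op:
  assumes g: "g \<in> L2 \<Omega>" and h: "h \<in> L2 \<Omega>"
  shows "\<langle>g, P h\<rangle> = \<langle>A g, A h\<rangle>"
proof -
  have i: "integrable (M \<Otimes>\<^sub>M M) (\<lambda>(x, y). A h x * k x y * g y)"
    by (rule triple_integrable[where B = "D * (\<integral>y. \<bar>h y\<bar> \<partial>M)"])
      (use op_bound[OF h] g op_L2[OF h] in \<open>auto intro: L2_measurable\<close>)
  have "\<langle>g, P h\<rangle> = (\<integral>y. (\<integral>x. A h x * k x y * g y \<partial>M) \<partial>M)"
    unfolding inner_L2_def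
  proof (rule Bochner_Integration.integral_cong[OF refl])
    fix y assume "y \<in> space M"
    then have "g y * P h y = (\<integral>x. g y * (k x y * A h x) \<partial>M)"
      by (simp add: gram_op_eq[OF h])
    then show "g y * P h y = (\<integral>x. A h x * k x y * g y \<partial>M)"
      by (simp only: ac_simps)
  qed
  also have "\<dots> = (\<integral>x. (\<integral>y. A h x * k x y * g y \<partial>M) \<partial>M)"
    using Fubini_integral[OF i] by simp
  also have "\<dots> = (\<integral>x. A h x * A g x \<partial>M)"
    by (simp add: integral_op_def mult.assoc)
  finally show ?thesis
    by (simp add: inner_L2_def mult.commute)
qed

lemma inner_gram_op_sym:
  assumes "g \<in> L2 \<Omega>" "h \<in> L2 \<Omega>" shows "\<langle>P g, h\<rangle> = \<langle>g, P h\<rangle>"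
  using inner_gram_op[OF assms] inner_gram_op[OF assms(2,1)] by (simp add: inner_commute)

lemma op_norm:
  assumes h: "h \<in> L2 \<Omega>"
  shows "\<langle>A h, A h\<rangle> \<le> D\<^sup>2 * (measure M \<Omega>)\<^sup>2 * \<langle>h, h\<rangle>"
proof -
  have row: "\<langle>k x, k x\<rangle> \<le> D\<^sup>2 * measure M \<Omega>" if "x \<in> \<Omega>" for x
  proof -
    have "\<langle>k x, k x\<rangle> \<le> (\<integral>y. D\<^sup>2 \<partial>M)"
      unfolding inner_L2_def
    proof (rule integral_mono)
      show "integrable M (\<lambda>y. k x y * k x y)"
        using kernel_section_L2(1)[OF that] by (intro L2_integrable_mult)
      show "k x y * k x y \<le> D\<^sup>2" if "y \<in> space M" for y
        using kernel_bound[of x y] \<open>x \<in> \<Omega>\<close> that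
        by (simp add: power2_eq_square[symmetric] abs_le_square_iff[symmetric])
    qed simp
    then show ?thesis by (simp add: mult.commute)
  qed
  have "\<langle>A h, A h\<rangle> \<le> (\<integral>x. D\<^sup>2 * measure M \<Omega> * \<langle>h, h\<rangle> \<partial>M)"
    unfolding inner_L2_def[of _ "A h"]
  proof (rule integral_mono)
    show "integrable M (\<lambda>x. A h x * A h x)"
      using op_L2[OF h] by (intro L2_integrable_mult)
    show "A h x * A h x \<le> D\<^sup>2 * measure M \<Omega> * \<langle>h, h\<rangle>" if "x \<in> space M" for x
    proof -
      have x: "x \<in> \<Omega>" using that by simp
      have "A h x * A h x \<le> \<langle>k x, k x\<rangle> * \<langle>h, h\<rangle>"
        using Cauchy_Schwarz[OF kernel_section_L2(1)[OF x] h] by (simp add: op_eq_inner power2_eq_square)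
      also have "\<dots> \<le> D\<^sup>2 * measure M \<Omega> * \<langle>h, h\<rangle>"
        by (intro mult_right_mono row[OF x] inner_nonneg)
      finally show ?thesis .
    qed
  qed simp
  then show ?thesis
    by (simp add: power2_eq_square algebra_simps)
qed

text \<open>Cauchy-Schwarz for the form \<open>\<langle>A g, A h\<rangle>\<close>, applied to \<open>g = P h\<close>.  With \<open>B\<close> the maximum of the
  Rayleigh quotient on an invariant subspace, this is what makes a maximising sequence asymptotically
  an eigenvector.\<close>

lemma gram_op_sq:
  assumes h: "h \<in> L2 \<Omega>" and "0 \<le> B"
    and B: "\<langle>A (P h), A (P h)\<rangle> \<le> B * \<langle>P h, P h\<rangle>"
  shows "\<langle>P h, P h\<rangle> \<le> B * \<langle>A h, A h\<rangle>"
proof (cases "\<langle>P h, P h\<rangle> = 0")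
  case True
  then show ?thesis
    using \<open>0 \<le> B\<close> inner_nonneg[of "A h"] by simp
next
  case False
  then have pos: "\<langle>P h, P h\<rangle> > 0"
    using inner_nonneg[of "P h"] by linarith
  have "\<langle>P h, P h\<rangle> * \<langle>P h, P h\<rangle> = \<langle>A (P h), A h\<rangle>\<^sup>2"
    using inner_gram_op[OF gram_op_L2[OF h] h] by (simp add: power2_eq_square)
  also have "\<dots> \<le> \<langle>A (P h), A (P h)\<rangle> * \<langle>A h, A h\<rangle>"
    by (intro Cauchy_Schwarz op_L2 gram_op_L2 h)
  also have "\<dots> \<le> (B * \<langle>P h, P h\<rangle>) * \<langle>A h, A h\<rangle>"
    by (intro mult_right_mono B inner_nonneg)
  finally show ?thesis
    using pos by (simp add: mult.assoc mult.left_commute[of B])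
qed

lemma gram_op_perp:
  assumes eig: "\<forall>k\<in>S. eigenpair_L2 \<Omega> P (\<kappa> k) (e k)" and h: "h \<in> perp S e"
  shows "P h \<in> perp S e"
proof -
  have h': "h \<in> L2 \<Omega>" "\<forall>k\<in>S. \<langle>h, e k\<rangle> = 0"
    using h by (auto simp: perp_def)
  have "\<langle>P h, e k\<rangle> = 0" if "k \<in> S" for k
  proof -
    have e: "e k \<in> L2 \<Omega>" "AE x in M. P (e k) x = \<kappa> k * e k x"
      using eig that by (auto simp: eigenpair_L2_def)
    have "\<langle>P h, e k\<rangle> = \<langle>h, P (e k)\<rangle>"
      by (rule inner_gram_op_sym) (use h' e in auto)
    also have "\<dots> = \<langle>h, \<lambda>x. \<kappa> k * e k x\<rangle>"
      using e h' by (intro inner_cong_AE L2_scale gram_op_L2) auto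
    finally show ?thesis
      using h' that by (simp add: inner_scale_right)
  qed
  then show ?thesis
    using gram_op_L2[OF h'(1)] by (simp add: perp_def)
qed

text \<open>On \<open>perp S e\<close>, which \<open>P\<close> maps to itself, let \<open>\<beta>\<close> be the supremum of \<open>\<langle>A h, A h\<rangle>\<close> over the unit
  ball.  A maximising sequence \<open>h n\<close> satisfies \<open>P (h n) - \<beta> * h n \<longlonglongrightarrow> 0\<close>, and by compactness \<open>P (h n)\<close>
  converges along a subsequence; so \<open>\<beta> * h n\<close> converges to the same limit, which is an eigenfunction
  with eigenvalue \<open>\<beta>\<close> in the same subspace.\<close>

lemma rayleigh_maximizer:
  assumes compact: "compact_op_L2 \<Omega> P"
    and eig: "\<forall>k\<in>S. eigenpair_L2 \<Omega> P (\<kappa> k) (e k)"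
    and g: "g \<in> perp S e" "\<langle>A g, A g\<rangle> > 0"
  obtains \<beta> \<phi> where "\<beta> > 0" "\<phi> \<in> perp S e" "eigenpair_L2 \<Omega> P \<beta> \<phi>" "\<langle>\<phi>, \<phi>\<rangle> \<noteq> 0"
    "\<And>h. h \<in> perp S e \<Longrightarrow> \<langle>A h, A h\<rangle> \<le> \<beta> * \<langle>h, h\<rangle>"
proof -
  have perp_L2: "h \<in> L2 \<Omega>" if "h \<in> perp S e" for h
    using that by (simp add: perp_def)
  define \<Lambda> where "\<Lambda> = D\<^sup>2 * (measure M \<Omega>)\<^sup>2"
  have "\<Lambda> \<ge> 0" by (simp add: \<Lambda>_def)
  have A_le: "\<langle>A h, A h\<rangle> \<le> \<Lambda> * \<langle>h, h\<rangle>" if "h \<in> L2 \<Omega>" for h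
    unfolding \<Lambda>_def by (rule op_norm) fact
  have P_le: "\<langle>P h, P h\<rangle> \<le> \<Lambda>\<^sup>2 * \<langle>h, h\<rangle>" if "h \<in> L2 \<Omega>" for h
  proof -
    have "\<langle>P h, P h\<rangle> \<le> \<Lambda> * \<langle>A h, A h\<rangle>"
      by (intro gram_op_sq that \<open>\<Lambda> \<ge> 0\<close> A_le gram_op_L2)
    also have "\<dots> \<le> \<Lambda> * (\<Lambda> * \<langle>h, h\<rangle>)"
      by (intro mult_left_mono A_le that \<open>\<Lambda> \<ge> 0\<close>)
    finally show ?thesis by (simp add: power2_eq_square mult.assoc)
  qed
  define R where "R = {\<langle>A h, A h\<rangle> |h. h \<in> perp S e \<and> \<langle>h, h\<rangle> \<le> 1}"
  have bdd: "bdd_above R"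
  proof (rule bdd_aboveI)
    fix r assume "r \<in> R"
    then obtain h where h: "r = \<langle>A h, A h\<rangle>" "h \<in> L2 \<Omega>" "\<langle>h, h\<rangle> \<le> 1"
      by (auto simp: R_def perp_def)
    show "r \<le> \<Lambda>"
      using A_le[OF h(2)] h(1) mult_left_mono[OF h(3) \<open>\<Lambda> \<ge> 0\<close>] by simp
  qed
  define \<beta> where "\<beta> = Sup R"
  have max: "\<langle>A h, A h\<rangle> \<le> \<beta> * \<langle>h, h\<rangle>" if h: "h \<in> perp S e" for h
  proof (cases "\<langle>h, h\<rangle> = 0")
    case True
    then show ?thesis using A_le[OF perp_L2[OF h]] by simp
  next
    case False
    then have pos: "\<langle>h, h\<rangle> > 0" using inner_nonneg[of h] by linarith
    define c where "c = 1 / sqrt \<langle>h, h\<rangle>"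
    have c: "c * c * \<langle>h, h\<rangle> = 1" using pos by (simp add: c_def)
    have "\<langle>A (\<lambda>y. c * h y), A (\<lambda>y. c * h y)\<rangle> = \<langle>\<lambda>y. c * A h y, \<lambda>y. c * A h y\<rangle>"
      unfolding inner_L2_def
      by (intro Bochner_Integration.integral_cong) (auto simp: op_scale[OF perp_L2[OF h]])
    also have "\<dots> = c * c * \<langle>A h, A h\<rangle>"
      by (simp add: inner_scale_left inner_scale_right)
    finally have "c * c * \<langle>A h, A h\<rangle> \<in> R"
      using h L2_scale[OF perp_L2[OF h], of c] c
      by (auto simp: R_def perp_def inner_scale_left inner_scale_right intro!: exI[of _ "\<lambda>y. c * h y"])
    then have "c * c * \<langle>A h, A h\<rangle> \<le> \<beta>"
      unfolding \<beta>_def using bdd by (rule cSup_upper)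
    then have "c * c * \<langle>A h, A h\<rangle> * \<langle>h, h\<rangle> \<le> \<beta> * \<langle>h, h\<rangle>"
      using pos by (intro mult_right_mono) auto
    moreover have "c * c * \<langle>A h, A h\<rangle> * \<langle>h, h\<rangle> = c * c * \<langle>h, h\<rangle> * \<langle>A h, A h\<rangle>"
      by simp
    ultimately show ?thesis using c by simp
  qed
  have "\<beta> > 0"
    using max[OF g(1)] g(2) inner_nonneg[of g] by (smt (verit) mult_nonpos_nonneg)
  have "R \<noteq> {}"
    using L2_const[of 0] by (auto simp: R_def perp_def inner_L2_def intro!: exI[of _ "\<lambda>_. 0"])
  have "\<exists>h\<in>perp S e. \<langle>h, h\<rangle> \<le> 1 \<and> \<beta> - 1 / real (Suc n) < \<langle>A h, A h\<rangle>" for n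
  proof -
    have "\<beta> - 1 / real (Suc n) < Sup R" unfolding \<beta>_def by simp
    then show ?thesis
      using less_cSup_iff[OF \<open>R \<noteq> {}\<close> bdd] by (auto simp: R_def)
  qed
  then obtain h where h: "\<And>n. h n \<in> perp S e" "\<And>n. \<langle>h n, h n\<rangle> \<le> 1"
      "\<And>n. \<beta> - 1 / real (Suc n) < \<langle>A (h n), A (h n)\<rangle>"
    by metis
  have A_lim: "(\<lambda>n. \<langle>A (h n), A (h n)\<rangle>) \<longlonglongrightarrow> \<beta>"
  proof (rule tendsto_sandwich[OF _ _ _ tendsto_const])
    have "(\<lambda>n. \<beta> - 1 / real (Suc n)) \<longlonglongrightarrow> \<beta> - 0"
      by (intro tendsto_intros LIMSEQ_Suc[OF lim_1_over_n])
    then show "(\<lambda>n. \<beta> - 1 / real (Suc n)) \<longlonglongrightarrow> \<beta>" by simp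
    show "\<forall>\<^sub>F n in sequentially. \<langle>A (h n), A (h n)\<rangle> \<le> \<beta>"
    proof (rule always_eventually, rule allI)
      fix n
      have "\<beta> * \<langle>h n, h n\<rangle> \<le> \<beta> * 1" using \<open>\<beta> > 0\<close> h(2) by (intro mult_left_mono) auto
      then show "\<langle>A (h n), A (h n)\<rangle> \<le> \<beta>" using max[OF h(1), of n] by simp
    qed
  qed (use h(3) in \<open>auto intro!: always_eventually less_imp_le\<close>)
  \<comment> \<open>Expand the square: \<open>\<langle>P h, P h\<rangle> - 2 \<beta> \<langle>A h, A h\<rangle> + \<beta>\<^sup>2 \<langle>h, h\<rangle>\<close>, bound the first term by
    \<open>\<beta> \<langle>A h, A h\<rangle>\<close> and the last by \<open>\<beta>\<^sup>2\<close>.\<close>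
  have near_eigen: "\<langle>\<lambda>x. P (h n) x - \<beta> * h n x, \<lambda>x. P (h n) x - \<beta> * h n x\<rangle>
      \<le> \<beta>\<^sup>2 - \<beta> * \<langle>A (h n), A (h n)\<rangle>" for n
  proof -
    have hL: "h n \<in> L2 \<Omega>" using h(1) by (rule perp_L2)
    have "\<langle>P (h n), P (h n)\<rangle> \<le> \<beta> * \<langle>A (h n), A (h n)\<rangle>"
      using \<open>\<beta> > 0\<close> by (intro gram_op_sq hL max gram_op_perp[OF eig h(1)]) auto
    moreover have "\<langle>P (h n), h n\<rangle> = \<langle>A (h n), A (h n)\<rangle>"
      using inner_gram_op[OF hL hL] by (simp add: inner_commute)
    moreover have "\<beta>\<^sup>2 * \<langle>h n, h n\<rangle> \<le> \<beta>\<^sup>2"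
      using h(2)[of n] by (simp add: mult_left_le)
    ultimately show ?thesis
      using norm_diff_sq[OF gram_op_L2[OF hL] hL, of \<beta>] by (simp add: power2_eq_square)
  qed
  have "norm_L2 \<Omega> (h n) \<le> 1" for n
    using h(2)[of n] by (simp add: norm_L2_def)
  then obtain r \<phi> where r: "strict_mono (r :: nat \<Rightarrow> nat)" and \<phi>: "\<phi> \<in> L2 \<Omega>"
    and conv: "(\<lambda>n. norm_L2 \<Omega> (\<lambda>x. P (h (r n)) x - \<phi> x)) \<longlonglongrightarrow> 0"
  proof -
    have "\<exists>r \<phi>. strict_mono (r :: nat \<Rightarrow> nat) \<and> \<phi> \<in> L2 \<Omega> \<and>
        (\<lambda>n. norm_L2 \<Omega> (\<lambda>x. P (h (r n)) x - \<phi> x)) \<longlonglongrightarrow> 0"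
      using compact h(1) perp_L2 \<open>\<And>n. norm_L2 \<Omega> (h n) \<le> 1\<close> unfolding compact_op_L2_def by blast
    then show thesis using that by blast
  qed
  \<comment> \<open>The limit \<open>\<phi>\<close> of \<open>P (h (r n))\<close> is also the limit of \<open>f\<close>.\<close>
  define f where "f = (\<lambda>n x. \<beta> * h (r n) x)"
  have f: "f n \<in> L2 \<Omega>" "f n \<in> perp S e" for n
    using h(1)[of "r n"] L2_scale[OF perp_L2[OF h(1)[of "r n"]], of \<beta>]
    by (auto simp: f_def perp_def inner_scale_left)
  have Ph: "P (h (r n)) \<in> L2 \<Omega>" for n
    using h(1) perp_L2 by (intro gram_op_L2) auto
  have \<phi>_Ph: "(\<lambda>n. \<langle>\<lambda>x. \<phi> x - P (h (r n)) x, \<lambda>x. \<phi> x - P (h (r n)) x\<rangle>) \<longlonglongrightarrow> 0"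
  proof -
    have "(\<lambda>n. (norm_L2 \<Omega> (\<lambda>x. P (h (r n)) x - \<phi> x))\<^sup>2) \<longlonglongrightarrow> 0\<^sup>2"
      by (intro tendsto_power conv)
    moreover have "(norm_L2 \<Omega> (\<lambda>x. P (h (r n)) x - \<phi> x))\<^sup>2
        = \<langle>\<lambda>x. \<phi> x - P (h (r n)) x, \<lambda>x. \<phi> x - P (h (r n)) x\<rangle>" for n
      by (simp add: norm_L2_def inner_nonneg) (simp add: inner_L2_def algebra_simps)
    ultimately show ?thesis by simp
  qed
  have \<phi>_f: "(\<lambda>n. \<langle>\<lambda>x. \<phi> x - f n x, \<lambda>x. \<phi> x - f n x\<rangle>) \<longlonglongrightarrow> 0"
  proof (rule tendsto_sandwich[OF _ _ tendsto_const])
    show "\<forall>\<^sub>F n in sequentially. \<langle>\<lambda>x. \<phi> x - f n x, \<lambda>x. \<phi> x - f n x\<rangle>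
        \<le> 2 * \<langle>\<lambda>x. \<phi> x - P (h (r n)) x, \<lambda>x. \<phi> x - P (h (r n)) x\<rangle>
          + 2 * (\<beta>\<^sup>2 - \<beta> * \<langle>A (h (r n)), A (h (r n))\<rangle>)"
    proof (rule always_eventually, rule allI)
      fix n
      show "\<langle>\<lambda>x. \<phi> x - f n x, \<lambda>x. \<phi> x - f n x\<rangle>
        \<le> 2 * \<langle>\<lambda>x. \<phi> x - P (h (r n)) x, \<lambda>x. \<phi> x - P (h (r n)) x\<rangle>
          + 2 * (\<beta>\<^sup>2 - \<beta> * \<langle>A (h (r n)), A (h (r n))\<rangle>)"
        using norm_triangle_sq[OF \<phi> Ph f(1), of n n] near_eigen[of "r n"] by (simp add: f_def)
    qed
    have "(\<lambda>n. 2 * \<langle>\<lambda>x. \<phi> x - P (h (r n)) x, \<lambda>x. \<phi> x - P (h (r n)) x\<rangle>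
          + 2 * (\<beta>\<^sup>2 - \<beta> * \<langle>A (h (r n)), A (h (r n))\<rangle>)) \<longlonglongrightarrow> 2 * 0 + 2 * (\<beta>\<^sup>2 - \<beta> * \<beta>)"
      by (intro tendsto_intros \<phi>_Ph LIMSEQ_subseq_LIMSEQ[OF A_lim r, unfolded comp_def])
    then show "(\<lambda>n. 2 * \<langle>\<lambda>x. \<phi> x - P (h (r n)) x, \<lambda>x. \<phi> x - P (h (r n)) x\<rangle>
          + 2 * (\<beta>\<^sup>2 - \<beta> * \<langle>A (h (r n)), A (h (r n))\<rangle>)) \<longlonglongrightarrow> 0"
      by (simp add: power2_eq_square)
  qed (use inner_nonneg in auto)
  have "\<phi> \<in> perp S e"
  proof -
    have "\<langle>\<phi>, e k\<rangle> = 0" if "k \<in> S" for k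
      by (rule orthogonal_limit[OF \<phi> f(1) \<phi>_f])
        (use that eig f(2) in \<open>auto simp: eigenpair_L2_def perp_def\<close>)
    with \<phi> show ?thesis by (simp add: perp_def)
  qed
  moreover have "eigenpair_L2 \<Omega> P \<beta> \<phi>"
  proof -
    define \<delta> where "\<delta> = (\<lambda>x. P \<phi> x - \<beta> * \<phi> x)"
    have \<delta>: "\<delta> \<in> L2 \<Omega>"
      unfolding \<delta>_def by (intro L2_diff gram_op_L2 \<phi>)
    have bound: "\<langle>\<delta>, \<delta>\<rangle> \<le> 2 * (\<Lambda>\<^sup>2 * \<langle>\<lambda>x. \<phi> x - f n x, \<lambda>x. \<phi> x - f n x\<rangle>)
        + 2 * (\<beta>\<^sup>2 * \<langle>\<lambda>x. \<phi> x - P (h (r n)) x, \<lambda>x. \<phi> x - P (h (r n)) x\<rangle>)" for n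
    proof -
      have hL: "h (r n) \<in> L2 \<Omega>" using h(1) by (rule perp_L2)
      have d1: "(\<lambda>x. \<phi> x - 1 * f n x) \<in> L2 \<Omega>" by (rule L2_diff[OF \<phi> f(1)])
      have "\<langle>\<delta>, \<delta>\<rangle> \<le> 2 * \<langle>\<lambda>x. P \<phi> x - \<beta> * P (h (r n)) x, \<lambda>x. P \<phi> x - \<beta> * P (h (r n)) x\<rangle>
         + 2 * \<langle>\<lambda>x. \<beta> * P (h (r n)) x - \<beta> * \<phi> x, \<lambda>x. \<beta> * P (h (r n)) x - \<beta> * \<phi> x\<rangle>"
        unfolding \<delta>_def by (intro norm_triangle_sq gram_op_L2 L2_scale \<phi> Ph)
      moreover have "\<langle>\<lambda>x. P \<phi> x - \<beta> * P (h (r n)) x, \<lambda>x. P \<phi> x - \<beta> * P (h (r n)) x\<rangle>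
          = \<langle>P (\<lambda>x. \<phi> x - 1 * f n x), P (\<lambda>x. \<phi> x - 1 * f n x)\<rangle>"
        unfolding inner_L2_def f_def
        by (intro Bochner_Integration.integral_cong)
          (auto simp: gram_op_diff[OF \<phi> hL])
      moreover have "\<dots> \<le> \<Lambda>\<^sup>2 * \<langle>\<lambda>x. \<phi> x - 1 * f n x, \<lambda>x. \<phi> x - 1 * f n x\<rangle>"
        by (rule P_le[OF d1])
      moreover have "\<langle>\<lambda>x. \<beta> * P (h (r n)) x - \<beta> * \<phi> x, \<lambda>x. \<beta> * P (h (r n)) x - \<beta> * \<phi> x\<rangle>
          = \<langle>\<lambda>x. (- \<beta>) * (\<phi> x - P (h (r n)) x), \<lambda>x. (- \<beta>) * (\<phi> x - P (h (r n)) x)\<rangle>"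
        by (simp add: algebra_simps)
      moreover have "\<dots> = \<beta>\<^sup>2 * \<langle>\<lambda>x. \<phi> x - P (h (r n)) x, \<lambda>x. \<phi> x - P (h (r n)) x\<rangle>"
        by (simp only: inner_scale_left inner_scale_right power2_eq_square minus_mult_minus mult.assoc)
      ultimately show ?thesis by simp
    qed
    have "(\<lambda>n. 2 * (\<Lambda>\<^sup>2 * \<langle>\<lambda>x. \<phi> x - f n x, \<lambda>x. \<phi> x - f n x\<rangle>)
        + 2 * (\<beta>\<^sup>2 * \<langle>\<lambda>x. \<phi> x - P (h (r n)) x, \<lambda>x. \<phi> x - P (h (r n)) x\<rangle>))
        \<longlonglongrightarrow> 2 * (\<Lambda>\<^sup>2 * 0) + 2 * (\<beta>\<^sup>2 * 0)"
      by (intro tendsto_intros \<phi>_f \<phi>_Ph)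
    then have "\<langle>\<delta>, \<delta>\<rangle> \<le> 2 * (\<Lambda>\<^sup>2 * 0) + 2 * (\<beta>\<^sup>2 * 0)"
      by (rule LIMSEQ_le_const) (use bound in auto)
    then have "\<langle>\<delta>, \<delta>\<rangle> = 0" using inner_nonneg[of \<delta>] by simp
    then have "AE x in M. \<delta> x = 0" using inner_eq_0_iff[OF \<delta>] by simp
    then show ?thesis
      using \<phi> by (simp add: eigenpair_L2_def \<delta>_def)
  qed
  \<comment> \<open>Otherwise \<open>h (r n)\<close> would tend to 0, although \<open>\<langle>A (h (r n)), A (h (r n))\<rangle>\<close> tends to \<open>\<beta> > 0\<close>.\<close>
  moreover have "\<langle>\<phi>, \<phi>\<rangle> \<noteq> 0"
  proof
    assume "\<langle>\<phi>, \<phi>\<rangle> = 0"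
    have "\<beta>\<^sup>2 * \<langle>A (h (r n)), A (h (r n))\<rangle> \<le> \<Lambda> * \<langle>\<lambda>x. \<phi> x - f n x, \<lambda>x. \<phi> x - f n x\<rangle>" for n
    proof -
      have "\<langle>\<phi>, f n\<rangle> = 0"
        using Cauchy_Schwarz[OF \<phi> f(1), of n] \<open>\<langle>\<phi>, \<phi>\<rangle> = 0\<close> by simp
      then have "\<langle>\<lambda>x. \<phi> x - f n x, \<lambda>x. \<phi> x - f n x\<rangle> = \<langle>f n, f n\<rangle>"
        using norm_diff_sq[OF \<phi> f(1), of 1 n] \<open>\<langle>\<phi>, \<phi>\<rangle> = 0\<close> by simp
      also have "\<dots> = \<beta>\<^sup>2 * \<langle>h (r n), h (r n)\<rangle>"
        by (simp add: f_def inner_scale_left inner_scale_right power2_eq_square)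
      finally have "\<Lambda> * \<langle>\<lambda>x. \<phi> x - f n x, \<lambda>x. \<phi> x - f n x\<rangle> = \<beta>\<^sup>2 * (\<Lambda> * \<langle>h (r n), h (r n)\<rangle>)"
        by simp
      moreover have "\<beta>\<^sup>2 * \<langle>A (h (r n)), A (h (r n))\<rangle> \<le> \<beta>\<^sup>2 * (\<Lambda> * \<langle>h (r n), h (r n)\<rangle>)"
        by (intro mult_left_mono A_le perp_L2 h(1)) simp
      ultimately show ?thesis by linarith
    qed
    moreover have "(\<lambda>n. \<Lambda> * \<langle>\<lambda>x. \<phi> x - f n x, \<lambda>x. \<phi> x - f n x\<rangle>) \<longlonglongrightarrow> \<Lambda> * 0"
      by (intro tendsto_intros \<phi>_f)
    moreover have "(\<lambda>n. \<beta>\<^sup>2 * \<langle>A (h (r n)), A (h (r n))\<rangle>) \<longlonglongrightarrow> \<beta>\<^sup>2 * \<beta>"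
      by (intro tendsto_intros LIMSEQ_subseq_LIMSEQ[OF A_lim r, unfolded comp_def])
    ultimately have "\<beta>\<^sup>2 * \<beta> \<le> \<Lambda> * 0"
      by (intro LIMSEQ_le) auto
    then show False using \<open>\<beta> > 0\<close> by (simp add: mult_le_0_iff)
  qed
  ultimately show thesis
    using that \<open>\<beta> > 0\<close> max by blast
qed

lemma eigenvectors_orthogonal:
  assumes "eigenpair_L2 \<Omega> P \<kappa> f" "eigenpair_L2 \<Omega> P \<kappa>' g" "\<kappa> \<noteq> \<kappa>'"
  shows "\<langle>f, g\<rangle> = 0"
proof -
  have f: "f \<in> L2 \<Omega>" "AE x in M. P f x = \<kappa> * f x" and g: "g \<in> L2 \<Omega>" "AE x in M. P g x = \<kappa>' * g x"
    using assms by (auto simp: eigenpair_L2_def)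
  have "\<kappa> * \<langle>f, g\<rangle> = \<langle>P f, g\<rangle>"
    using f g by (subst inner_cong_AE[of "P f" "\<lambda>x. \<kappa> * f x" g g])
      (auto intro: L2_scale gram_op_L2 simp: inner_scale_left)
  also have "\<dots> = \<langle>f, P g\<rangle>"
    using f g by (intro inner_gram_op_sym)
  also have "\<dots> = \<kappa>' * \<langle>f, g\<rangle>"
    using f g by (subst inner_cong_AE[of f f "P g" "\<lambda>x. \<kappa>' * g x"])
      (auto intro: L2_scale gram_op_L2 simp: inner_scale_right)
  finally show ?thesis using assms(3) by simp
qed

lemma eigenvalue_eq:
  assumes "eigenpair_L2 \<Omega> P \<kappa> f"
  shows "\<langle>A f, A f\<rangle> = \<kappa> * \<langle>f, f\<rangle>"
proof -
  have f: "f \<in> L2 \<Omega>" "AE x in M. P f x = \<kappa> * f x"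
    using assms by (auto simp: eigenpair_L2_def)
  have "\<langle>A f, A f\<rangle> = \<langle>f, P f\<rangle>"
    using inner_gram_op[OF f(1) f(1)] by simp
  also have "\<dots> = \<kappa> * \<langle>f, f\<rangle>"
    using f by (subst inner_cong_AE[of f f "P f" "\<lambda>x. \<kappa> * f x"])
      (auto intro: L2_scale gram_op_L2 simp: inner_scale_right)
  finally show ?thesis .
qed

lemma listed_eigenvalue:
  assumes "eigen_listing \<Omega> P lam z" "eigenpair_L2 \<Omega> P \<kappa> f" "\<kappa> \<noteq> 0" "\<langle>f, f\<rangle> \<noteq> 0"
  obtains j where "j \<ge> 1" "lam j = \<kappa>" "\<langle>f, z j\<rangle> \<noteq> 0"
proof -
  have "f \<in> L2 \<Omega>" using assms(2) by (simp add: eigenpair_L2_def)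
  then have "\<not> (AE x in M. f x = 0)"
    using inner_eq_0_iff assms(4) by blast
  then obtain j where j: "j \<ge> 1" "\<langle>f, z j\<rangle> \<noteq> 0"
    using assms(1-3) unfolding eigen_listing_def by blast
  moreover have "eigenpair_L2 \<Omega> P (lam j) (z j)"
    using assms(1) j unfolding eigen_listing_def by blast
  ultimately show ?thesis
    using that eigenvectors_orthogonal[OF assms(2)] by metis
qed

text \<open>\<open>f\<close> is a multiple of \<open>P f\<close> almost everywhere, and \<open>P f\<close> is bounded because the kernel is.\<close>

lemma eigenfunction_bounded:
  assumes "eigenpair_L2 \<Omega> P \<kappa> f" "\<kappa> \<noteq> 0"
  obtains B where "AE x in M. \<bar>f x\<bar> \<le> B"
proof
  have f: "f \<in> L2 \<Omega>" "AE x in M. P f x = \<kappa> * f x"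
    using assms(1) by (auto simp: eigenpair_L2_def)
  show "AE x in M. \<bar>f x\<bar> \<le> D * (\<integral>x. \<bar>A f x\<bar> \<partial>M) / \<bar>\<kappa>\<bar>"
    using f(2) AE_Omega
  proof eventually_elim
    case (elim x)
    have "\<bar>\<kappa>\<bar> * \<bar>f x\<bar> = \<bar>P f x\<bar>" by (simp add: elim(1) abs_mult)
    also have "\<dots> \<le> D * (\<integral>x. \<bar>A f x\<bar> \<partial>M)" by (rule gram_op_bound[OF f(1) elim(2)])
    finally show ?case using assms(2) by (simp add: field_simps)
  qed
qed

lemma listed_eigenvalue_nonneg:
  assumes "eigen_listing \<Omega> P lam z" "j \<ge> 1"
  shows "0 \<le> lam j"
proof -
  have "eigenpair_L2 \<Omega> P (lam j) (z j)" "\<langle>z j, z j\<rangle> = 1"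
    using assms by (auto simp: eigen_listing_def)
  then show ?thesis
    using eigenvalue_eq[of "lam j" "z j"] inner_nonneg[of "A (z j)"] by simp
qed

text \<open>The half of the Courant-Fischer principle that bounds the Rayleigh quotient of \<open>w\<close>.  If the maximum
  \<open>\<beta>\<close> over the functions orthogonal to these \<open>z k\<close> is positive, it is an eigenvalue attained there, and
  completeness of the listing makes it some \<open>lam j\<close> with an eigenfunction not orthogonal to \<open>z j\<close>; as
  \<open>lam j = \<beta> \<noteq> 0\<close>, this is only possible for \<open>j > m\<close>, whence \<open>\<beta> \<le> lam (Suc m)\<close>.  The whole spectral
  expansion of \<open>w\<close> is thus replaced by one maximisation.\<close>

theorem rayleigh_bound:
  assumes compact: "compact_op_L2 \<Omega> P" and listing: "eigen_listing \<Omega> P lam z"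
    and w: "w \<in> L2 \<Omega>" "\<And>k. k \<in> {1..m} \<Longrightarrow> lam k \<noteq> 0 \<Longrightarrow> \<langle>w, z k\<rangle> = 0"
  shows "\<langle>A w, A w\<rangle> \<le> lam (Suc m) * \<langle>w, w\<rangle>"
proof (cases "\<langle>A w, A w\<rangle> > 0")
  case True
  define S where "S = {k \<in> {1..m}. lam k \<noteq> 0}"
  have eig: "eigenpair_L2 \<Omega> P (lam k) (z k)" if "k \<ge> 1" for k
    using listing that by (simp add: eigen_listing_def)
  have "\<forall>k\<in>S. eigenpair_L2 \<Omega> P (lam k) (z k)"
    using eig by (auto simp: S_def)
  moreover have w_perp: "w \<in> perp S z"
    using w by (auto simp: perp_def S_def)
  ultimately obtain \<beta> \<phi> where \<beta>: "\<beta> > 0" "\<phi> \<in> perp S z" "eigenpair_L2 \<Omega> P \<beta> \<phi>" "\<langle>\<phi>, \<phi>\<rangle> \<noteq> 0"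
    "\<And>h. h \<in> perp S z \<Longrightarrow> \<langle>A h, A h\<rangle> \<le> \<beta> * \<langle>h, h\<rangle>"
    using rayleigh_maximizer[OF compact, of S lam z w] True by metis
  obtain j where j: "j \<ge> 1" "lam j = \<beta>" "\<langle>\<phi>, z j\<rangle> \<noteq> 0"
    using listed_eigenvalue[OF listing \<beta>(3)] \<beta>(1,4) by auto
  then have "j \<notin> S" using \<beta>(2) by (auto simp: perp_def)
  then have "j \<ge> Suc m" using j \<beta>(1) by (auto simp: S_def)
  then have "\<beta> \<le> lam (Suc m)"
    using listing j by (auto simp: eigen_listing_def)
  then show ?thesis
    using \<beta>(5)[OF w_perp] inner_nonneg[of w] by (meson mult_right_mono order_trans)
next
  case False
  have "0 \<le> lam (Suc m)"
    by (rule listed_eigenvalue_nonneg[OF listing]) simp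
  then have "0 \<le> lam (Suc m) * \<langle>w, w\<rangle>" using inner_nonneg[of w] by simp
  then show ?thesis using False by linarith
qed

end

section \<open>The mixture model and its top eigenvalue\<close>

text \<open>One pair of constants \<open>c\<close>, \<open>D\<close> bounds both \<open>g0\<close> and \<open>K\<close>; \<open>f0\<close> then has the same
  bounds, as it averages \<open>K\<close> over the probability density \<open>g0\<close>.\<close>

locale mixture_model = finite_L2 +
  fixes g0 :: "real \<Rightarrow> real" and K :: "real \<Rightarrow> real \<Rightarrow> real" and c D :: real
  assumes c_pos: "0 < c"
    and g0_measurable [measurable]: "g0 \<in> borel_measurable M"
    and g0_bounds: "\<And>\<mu>. \<mu> \<in> \<Omega> \<Longrightarrow> c \<le> g0 \<mu>" "\<And>\<mu>. \<mu> \<in> \<Omega> \<Longrightarrow> g0 \<mu> \<le> D"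
    and g0_integral: "(\<integral>\<mu>. g0 \<mu> \<partial>M) = 1"
    and K_measurable: "(\<lambda>(\<mu>, x). K \<mu> x) \<in> borel_measurable (M \<Otimes>\<^sub>M M)"
    and K_bounds: "\<And>\<mu> x. \<mu> \<in> \<Omega> \<Longrightarrow> x \<in> \<Omega> \<Longrightarrow> c \<le> K \<mu> x"
      "\<And>\<mu> x. \<mu> \<in> \<Omega> \<Longrightarrow> x \<in> \<Omega> \<Longrightarrow> K \<mu> x \<le> D"
    and K_integral: "\<And>\<mu>. \<mu> \<in> \<Omega> \<Longrightarrow> (\<integral>x. K \<mu> x \<partial>M) = 1"
begin

lemma K_measurable' [measurable (raw)]:
  assumes "f \<in> measurable N M" "g \<in> measurable N M"
  shows "(\<lambda>w. K (f w) (g w)) \<in> borel_measurable N"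
  using measurable_compose[OF measurable_Pair[OF assms] K_measurable] by simp

lemma Omega_nonempty: "\<Omega> \<noteq> {}"
proof
  assume "\<Omega> = {}"
  then have "(\<integral>\<mu>. g0 \<mu> \<partial>M) = (\<integral>\<mu>. 0 \<partial>M)"
    by (intro Bochner_Integration.integral_cong) auto
  then show False using g0_integral by simp
qed

lemma D_pos: "0 < D"
proof -
  obtain \<mu> where "\<mu> \<in> \<Omega>" using Omega_nonempty by blast
  then show ?thesis using g0_bounds[of \<mu>] c_pos by linarith
qed

lemma measure_pos: "0 < measure M \<Omega>"
proof (rule ccontr)
  assume "\<not> 0 < measure M \<Omega>"
  then have "measure M (space M) = 0"
    using measure_nonneg[of M \<Omega>] by simp
  then have "AE x in M. g0 x = 0"
    using emeasure_eq_measure[of "space M"] by (intro AE_I[of _ _ "space M"]) auto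
  then have "(\<integral>\<mu>. g0 \<mu> \<partial>M) = (\<integral>\<mu>. 0 \<partial>M)"
    by (intro integral_cong_AE) auto
  then show False using g0_integral by simp
qed

lemma g0_integrable: "integrable M g0"
  by (rule integrable_const_bound[of _ D])
    (use g0_bounds c_pos in \<open>auto intro!: AE_I2 simp: abs_of_pos less_le_trans\<close>)

lemma K_section_measurable [measurable]:
  assumes "x \<in> \<Omega>" shows "(\<lambda>\<mu>. K \<mu> x) \<in> borel_measurable M" "K x \<in> borel_measurable M"
proof -
  have [measurable]: "(\<lambda>y. x) \<in> measurable M M" using assms by simp
  show "(\<lambda>\<mu>. K \<mu> x) \<in> borel_measurable M" "K x \<in> borel_measurable M"
    by measurable
qed

lemma K_abs_bound: "\<mu> \<in> \<Omega> \<Longrightarrow> x \<in> \<Omega> \<Longrightarrow> \<bar>K \<mu> x\<bar> \<le> D"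
  using K_bounds[of \<mu> x] c_pos by simp

lemma K_mult_integrable:
  assumes g: "integrable M g" and x: "x \<in> \<Omega>"
  shows "integrable M (\<lambda>\<mu>. K \<mu> x * g \<mu>)"
proof (rule Bochner_Integration.integrable_bound)
  show "integrable M (\<lambda>\<mu>. D * g \<mu>)" using g by simp
  show "AE \<mu> in M. norm (K \<mu> x * g \<mu>) \<le> norm (D * g \<mu>)"
    using K_abs_bound[OF _ x] D_pos by (auto intro!: AE_I2 mult_right_mono simp: abs_mult)
  have [measurable]: "g \<in> borel_measurable M" using g by simp
  show "(\<lambda>\<mu>. K \<mu> x * g \<mu>) \<in> borel_measurable M" using x by measurable
qed

lemma marginal_measurable [measurable]:
  assumes [measurable]: "g \<in> borel_measurable M"
  shows "marginal \<Omega> K g \<in> borel_measurable M"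
  unfolding marginal_def by measurable

lemma marginal_integral:
  assumes g: "integrable M g"
  shows "integrable M (marginal \<Omega> K g)" "(\<integral>x. marginal \<Omega> K g x \<partial>M) = (\<integral>\<mu>. g \<mu> \<partial>M)"
proof -
  have [measurable]: "g \<in> borel_measurable M" using g by simp
  have "integrable (M \<Otimes>\<^sub>M M) (\<lambda>(\<mu>, x). K \<mu> x * g \<mu>)"
  proof (rule Bochner_Integration.integrable_bound)
    show "integrable (M \<Otimes>\<^sub>M M) (\<lambda>(\<mu>, x). D * g \<mu>)"
      by (rule Fubini_integrable) (use g in auto)
    show "AE w in M \<Otimes>\<^sub>M M. norm (case w of (\<mu>, x) \<Rightarrow> K \<mu> x * g \<mu>)
        \<le> norm (case w of (\<mu>, x) \<Rightarrow> D * g \<mu>)"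
      using K_abs_bound D_pos
      by (auto intro!: AE_I2 mult_right_mono simp: space_pair_measure abs_mult)
  qed measurable
  note i = this
  have "integrable (M \<Otimes>\<^sub>M M) (\<lambda>(x, \<mu>). K \<mu> x * g \<mu>)"
    using integrable_product_swap[OF i] by (simp add: case_prod_beta')
  from integrable_fst'[OF this] show "integrable M (marginal \<Omega> K g)"
    by (simp add: marginal_def)
  have "(\<integral>x. marginal \<Omega> K g x \<partial>M) = (\<integral>\<mu>. (\<integral>x. K \<mu> x * g \<mu> \<partial>M) \<partial>M)"
    unfolding marginal_def using Fubini_integral[OF i] by simp
  also have "\<dots> = (\<integral>\<mu>. g \<mu> \<partial>M)"
    by (intro Bochner_Integration.integral_cong) (auto simp: K_integral)
  finally show "(\<integral>x. marginal \<Omega> K g x \<partial>M) = (\<integral>\<mu>. g \<mu> \<partial>M)" .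
qed

abbreviation "f0 \<equiv> marginal \<Omega> K g0"

lemma f0_bounds:
  assumes x: "x \<in> \<Omega>" shows "c \<le> f0 x" "f0 x \<le> D"
proof -
  have g0_nonneg: "0 \<le> g0 \<mu>" if "\<mu> \<in> \<Omega>" for \<mu>
    using g0_bounds(1)[OF that] c_pos by linarith
  note int = K_mult_integrable[OF g0_integrable x] integrable_mult_right[OF g0_integrable]
  have "(\<integral>\<mu>. c * g0 \<mu> \<partial>M) \<le> (\<integral>\<mu>. K \<mu> x * g0 \<mu> \<partial>M)"
      "(\<integral>\<mu>. K \<mu> x * g0 \<mu> \<partial>M) \<le> (\<integral>\<mu>. D * g0 \<mu> \<partial>M)"
    by (intro integral_mono int mult_right_mono; use K_bounds[OF _ x] g0_nonneg in simp)+
  then have "(\<integral>\<mu>. c * g0 \<mu> \<partial>M) \<le> f0 x" "f0 x \<le> (\<integral>\<mu>. D * g0 \<mu> \<partial>M)"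
    unfolding marginal_def .
  then show "c \<le> f0 x" "f0 x \<le> D"
    by (simp_all add: g0_integral)
qed

lemma f0_pos: "x \<in> \<Omega> \<Longrightarrow> 0 < f0 x"
  using f0_bounds(1) c_pos by force

lemma g0_pos: "\<mu> \<in> \<Omega> \<Longrightarrow> 0 < g0 \<mu>"
  using g0_bounds(1) c_pos by force

abbreviation "s \<equiv> \<lambda>\<mu>. sqrt (g0 \<mu>)"

lemma s_L2: "s \<in> L2 \<Omega>"
  by (rule L2_bounded[of _ "sqrt D"])
    (use g0_bounds g0_pos in \<open>auto intro!: AE_I2 simp: abs_of_pos\<close>)

lemma s_norm: "\<langle>s, s\<rangle> = 1"
proof -
  have "\<langle>s, s\<rangle> = (\<integral>\<mu>. g0 \<mu> \<partial>M)"
    unfolding inner_L2_def using g0_pos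
    by (intro Bochner_Integration.integral_cong) (auto simp: less_imp_le)
  then show ?thesis by (simp add: g0_integral)
qed

text \<open>Dividing by \<open>sqrt (f0 x)\<close> turns the chi-squared norm of a perturbation of \<open>f0\<close> into a plain
  \<open>L2\<close> norm, and splits the weight \<open>1 / f0 x\<close> in \<open>P_kernel\<close> evenly between the two factors.\<close>

definition whitened_kernel :: "real \<Rightarrow> real \<Rightarrow> real" where
  "whitened_kernel x \<mu> = K \<mu> x * s \<mu> / sqrt (f0 x)"

sublocale gram_kernel \<Omega> whitened_kernel "P_kernel \<Omega> K g0" "D * sqrt D / sqrt c"
proof
  show "(\<lambda>(x, y). whitened_kernel x y) \<in> borel_measurable (M \<Otimes>\<^sub>M M)"
    unfolding whitened_kernel_def by measurable
  show "\<bar>whitened_kernel x \<mu>\<bar> \<le> D * sqrt D / sqrt c" if "x \<in> \<Omega>" "\<mu> \<in> \<Omega>" for x \<mu>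
    unfolding whitened_kernel_def abs_mult abs_divide
    using that K_abs_bound[of \<mu> x] g0_bounds[of \<mu>] g0_pos[of \<mu>] f0_bounds[of x] f0_pos[of x] c_pos D_pos
    by (intro frac_le mult_mono) auto
  show "P_kernel \<Omega> K g0 \<mu> \<mu>' = (\<integral>x. whitened_kernel x \<mu> * whitened_kernel x \<mu>' \<partial>M)" for \<mu> \<mu>'
    unfolding P_kernel_def
  proof (rule Bochner_Integration.integral_cong[OF refl])
    fix x assume "x \<in> space M"
    then have "inverse (f0 x) = 1 / (sqrt (f0 x) * sqrt (f0 x))"
      using f0_pos[of x] by (simp add: inverse_eq_divide)
    then show "sqrt (g0 \<mu>) * K \<mu> x * inverse (f0 x) * K \<mu>' x * sqrt (g0 \<mu>')
        = whitened_kernel x \<mu> * whitened_kernel x \<mu>'"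
      by (simp add: whitened_kernel_def)
  qed
qed

lemma op_eq_marginal: "A h x = marginal \<Omega> K (\<lambda>\<mu>. s \<mu> * h \<mu>) x / sqrt (f0 x)"
proof -
  have "A h x = (\<integral>\<mu>. K \<mu> x * (s \<mu> * h \<mu>) / sqrt (f0 x) \<partial>M)"
    by (simp add: integral_op_def whitened_kernel_def mult.assoc)
  then show ?thesis
    by (simp add: marginal_def)
qed

lemma op_carrier:
  assumes "x \<in> \<Omega>" shows "A s x = sqrt (f0 x)"
proof -
  have "marginal \<Omega> K (\<lambda>\<mu>. s \<mu> * s \<mu>) x = f0 x"
    unfolding marginal_def using g0_pos
    by (intro Bochner_Integration.integral_cong) (auto simp: less_imp_le)
  then show ?thesis
    using f0_pos[OF assms] by (simp add: op_eq_marginal real_div_sqrt)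
qed

lemma carrier_eigenpair: "eigenpair_L2 \<Omega> P 1 s"
proof -
  have "P s \<mu> = s \<mu>" if \<mu>: "\<mu> \<in> \<Omega>" for \<mu>
  proof -
    have "P s \<mu> = (\<integral>x. s \<mu> * K \<mu> x \<partial>M)"
      unfolding gram_op_eq[OF s_L2 \<mu>] using f0_pos
      by (intro Bochner_Integration.integral_cong) (auto simp: op_carrier whitened_kernel_def less_imp_neq[symmetric])
    then show ?thesis by (simp add: K_integral[OF \<mu>])
  qed
  then show ?thesis
    using s_L2 by (auto simp: eigenpair_L2_def intro!: AE_I2)
qed

text \<open>For fixed \<open>x\<close>, the weight \<open>\<lambda>\<mu>. K \<mu> x * g0 \<mu>\<close> has total mass \<open>f0 x\<close> and is at least \<open>c * g0 \<mu>\<close>,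
  so the variance of \<open>h / s\<close> under it is at least \<open>c\<close> times the variance under \<open>g0\<close>, which is
  \<open>\<langle>h, h\<rangle> - \<langle>h, s\<rangle>\<^sup>2\<close>.  Variance is second moment minus squared mean, and the squared mean term is
  \<open>(A h x)\<^sup>2\<close>; integrating over \<open>x\<close> turns the second moment into \<open>\<langle>h, h\<rangle>\<close>.\<close>

lemma spectral_gap:
  assumes h: "h \<in> L2 \<Omega>"
  shows "\<langle>A h, A h\<rangle> \<le> \<langle>h, h\<rangle> - c * measure M \<Omega> * (\<langle>h, h\<rangle> - \<langle>h, s\<rangle>\<^sup>2)"
proof -
  define V where "V = \<langle>h, h\<rangle> - \<langle>h, s\<rangle>\<^sup>2"
  have hh: "integrable M (\<lambda>\<mu>. h \<mu> * h \<mu>)" and sh: "integrable M (\<lambda>\<mu>. s \<mu> * h \<mu>)"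
    and ss: "integrable M (\<lambda>\<mu>. s \<mu> * s \<mu>)"
    by (rule L2_integrable_mult[OF h h] L2_integrable_mult[OF s_L2 h] L2_integrable_mult[OF s_L2 s_L2])+
  have pointwise: "A h x * A h x \<le> marginal \<Omega> K (\<lambda>\<mu>. h \<mu> * h \<mu>) x - c * V" if x: "x \<in> \<Omega>" for x
  proof -
    \<comment> \<open>\<open>m\<close> is the mean of \<open>h / s\<close> under the conditional density of \<open>\<mu>\<close> given \<open>x\<close>.\<close>
    define m where "m = marginal \<Omega> K (\<lambda>\<mu>. s \<mu> * h \<mu>) x / f0 x"
    have f0: "0 < f0 x" using f0_pos[OF x] .
    have d: "(\<lambda>\<mu>. h \<mu> - m * s \<mu>) \<in> L2 \<Omega>" by (rule L2_diff[OF h s_L2])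
    have "c * V \<le> c * \<langle>\<lambda>\<mu>. h \<mu> - m * s \<mu>, \<lambda>\<mu>. h \<mu> - m * s \<mu>\<rangle>"
    proof (rule mult_left_mono)
      have "0 \<le> (\<langle>h, s\<rangle> - m)\<^sup>2" by simp
      then show "V \<le> \<langle>\<lambda>\<mu>. h \<mu> - m * s \<mu>, \<lambda>\<mu>. h \<mu> - m * s \<mu>\<rangle>"
        unfolding norm_diff_sq[OF h s_L2] V_def s_norm by (simp add: power2_eq_square algebra_simps)
    qed (use c_pos in simp)
    also have "\<dots> = (\<integral>\<mu>. c * ((h \<mu> - m * s \<mu>) * (h \<mu> - m * s \<mu>)) \<partial>M)"
      by (simp add: inner_L2_def)
    also have "\<dots> \<le> (\<integral>\<mu>. K \<mu> x * ((h \<mu> - m * s \<mu>) * (h \<mu> - m * s \<mu>)) \<partial>M)"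
      by (intro integral_mono integrable_mult_right K_mult_integrable x L2_integrable_mult d mult_right_mono)
        (use K_bounds[OF _ x] in auto)
    also have "\<dots> = (\<integral>\<mu>. K \<mu> x * (h \<mu> * h \<mu>) - 2 * m * (K \<mu> x * (s \<mu> * h \<mu>))
        + m * m * (K \<mu> x * (s \<mu> * s \<mu>)) \<partial>M)"
      by (simp add: algebra_simps)
    also have "\<dots> = marginal \<Omega> K (\<lambda>\<mu>. h \<mu> * h \<mu>) x - 2 * m * marginal \<Omega> K (\<lambda>\<mu>. s \<mu> * h \<mu>) x
        + m * m * marginal \<Omega> K (\<lambda>\<mu>. s \<mu> * s \<mu>) x"
      using K_mult_integrable[OF hh x] K_mult_integrable[OF sh x] K_mult_integrable[OF ss x]
      by (simp add: marginal_def)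
    also have "marginal \<Omega> K (\<lambda>\<mu>. s \<mu> * s \<mu>) x = f0 x"
      using op_carrier[OF x] f0 by (simp add: op_eq_marginal field_simps)
    also have "marginal \<Omega> K (\<lambda>\<mu>. h \<mu> * h \<mu>) x - 2 * m * marginal \<Omega> K (\<lambda>\<mu>. s \<mu> * h \<mu>) x + m * m * f0 x
        = marginal \<Omega> K (\<lambda>\<mu>. h \<mu> * h \<mu>) x - A h x * A h x"
      using f0 by (simp add: m_def op_eq_marginal field_simps)
    finally show ?thesis by simp
  qed
  have "\<langle>A h, A h\<rangle> \<le> (\<integral>x. marginal \<Omega> K (\<lambda>\<mu>. h \<mu> * h \<mu>) x - c * V \<partial>M)"
    unfolding inner_L2_def
    by (intro integral_mono L2_integrable_mult[OF op_L2[OF h] op_L2[OF h]] Bochner_Integration.integrable_diff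
        marginal_integral(1)[OF hh] integrable_const) (use pointwise in auto)
  also have "\<dots> = \<langle>h, h\<rangle> - c * measure M \<Omega> * V"
    using marginal_integral[OF hh] by (simp add: inner_L2_def)
  finally show ?thesis by (simp add: V_def)
qed

text \<open>Since 1 is an eigenvalue it is listed, so \<open>lam 1 \<ge> 1\<close>; the spectral gap bounds \<open>lam 1\<close> by 1 with
  equality only if \<open>z 1\<close> is parallel to \<open>s\<close>.  Hence later eigenfunctions are orthogonal to \<open>s\<close>.\<close>

lemma top_eigenpair:
  assumes listing: "eigen_listing \<Omega> P lam z"
  shows "lam 1 = 1" "\<langle>z 1, s\<rangle>\<^sup>2 = 1" "AE \<mu> in M. z 1 \<mu> = \<langle>z 1, s\<rangle> * s \<mu>"
    "\<And>k. k \<ge> 2 \<Longrightarrow> \<langle>z k, s\<rangle> = 0"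
proof -
  have z_L2: "z k \<in> L2 \<Omega>" if "k \<ge> 1" for k
    using listing that by (auto simp: eigen_listing_def eigenpair_L2_def)
  have z1: "eigenpair_L2 \<Omega> P (lam 1) (z 1)" "\<langle>z 1, z 1\<rangle> = 1" "z 1 \<in> L2 \<Omega>"
    using listing z_L2 by (auto simp: eigen_listing_def)
  obtain j where "j \<ge> 1" "lam j = 1"
    using listed_eigenvalue[OF listing carrier_eigenpair] s_norm by auto
  then have "lam 1 \<ge> 1"
    using listing unfolding eigen_listing_def by (metis order_refl)
  moreover have "lam 1 \<le> 1 - c * measure M \<Omega> * (1 - \<langle>z 1, s\<rangle>\<^sup>2)"
    using spectral_gap[OF z1(3)] eigenvalue_eq[OF z1(1)] z1(2) by simp
  moreover have le: "\<langle>z 1, s\<rangle>\<^sup>2 \<le> 1"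
    using Cauchy_Schwarz[OF z1(3) s_L2] z1(2) s_norm by simp
  moreover have pos: "0 < c * measure M \<Omega>"
    using c_pos measure_pos by simp
  moreover have "0 \<le> c * measure M \<Omega> * (1 - \<langle>z 1, s\<rangle>\<^sup>2)"
    by (rule mult_nonneg_nonneg[OF less_imp_le[OF pos]]) (use le in simp)
  ultimately have "c * measure M \<Omega> * (1 - \<langle>z 1, s\<rangle>\<^sup>2) = 0" and lam1: "lam 1 = 1"
    by linarith+
  then show sq: "\<langle>z 1, s\<rangle>\<^sup>2 = 1" using c_pos measure_pos by auto
  show "lam 1 = 1" by (rule lam1)
  define d where "d = (\<lambda>\<mu>. z 1 \<mu> - \<langle>z 1, s\<rangle> * s \<mu>)"
  have "\<langle>d, d\<rangle> = 0"
    unfolding d_def norm_diff_sq[OF z1(3) s_L2] z1(2) s_norm using sq by (simp add: power2_eq_square)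
  then show parallel: "AE \<mu> in M. z 1 \<mu> = \<langle>z 1, s\<rangle> * s \<mu>"
    using inner_eq_0_iff[of d] L2_diff[OF z1(3) s_L2] by (simp add: d_def)
  show "\<langle>z k, s\<rangle> = 0" if "k \<ge> 2" for k
  proof -
    have "0 = \<langle>z k, z 1\<rangle>"
      using listing that unfolding eigen_listing_def by auto
    also have "\<dots> = \<langle>z k, \<lambda>\<mu>. \<langle>z 1, s\<rangle> * s \<mu>\<rangle>"
      using parallel that by (intro inner_cong_AE z_L2 L2_scale s_L2) auto
    finally show ?thesis
      using sq by (auto simp: inner_scale_right)
  qed
qed

end

section \<open>Kullback-Leibler divergence under root-n perturbations\<close>

text \<open>The remainder quotient of \<open>(1 + r) * ln (1 + r) - r \<approx> r\<^sup>2 / 2\<close>, completed by its limit at 0 so that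
  it is continuous there: along a sequence, the relative difference \<open>r\<close> of two densities may vanish.\<close>

definition KL_ratio :: "real \<Rightarrow> real" where
  "KL_ratio r = (if r = 0 then 1 / 2 else ((1 + r) * ln (1 + r) - r) / r\<^sup>2)"

lemma KL_ratio_tendsto: "(KL_ratio \<longlongrightarrow> 1 / 2) (nhds 0)"
proof -
  have "((\<lambda>r. ((1 + r) * ln (1 + r) - r) / r\<^sup>2) \<longlongrightarrow> 1 / 2) (at (0::real))"
    by real_asymp
  then have "(KL_ratio \<longlongrightarrow> 1 / 2) (at 0)"
    by (rule tendsto_cong[THEN iffD2, rotated]) (auto simp: KL_ratio_def eventually_at_filter)
  moreover have "KL_ratio 0 = 1 / 2" by (simp add: KL_ratio_def)
  ultimately show ?thesis
    using tendsto_nhds_iff[of KL_ratio "1 / 2" 0] by simp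
qed

lemma KL_integrand_eq:
  fixes u v :: real
  assumes "0 < u" "0 < v"
  shows "u * ln (u / v) - u + v = (u - v)\<^sup>2 / v * KL_ratio (u / v - 1)"
proof (cases "u = v")
  case False
  define y where "y = u / v"
  have u: "u = y * v" and "y \<noteq> 1" using assms False by (auto simp: y_def)
  have "(u - v)\<^sup>2 / v = v * (y - 1)\<^sup>2"
    using assms(2) by (simp add: u power2_eq_square field_simps)
  moreover have "KL_ratio (y - 1) = (y * ln y - (y - 1)) / (y - 1)\<^sup>2"
    using \<open>y \<noteq> 1\<close> by (simp add: KL_ratio_def)
  ultimately have "(u - v)\<^sup>2 / v * KL_ratio (y - 1) = v * (y * ln y - (y - 1))"
    using \<open>y \<noteq> 1\<close> by simp
  then show ?thesis
    unfolding y_def[symmetric] by (simp add: u algebra_simps)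
qed (use assms in simp)

lemma KL_integrand_bounds:
  fixes u v :: real
  assumes "0 < u" "0 < v"
  shows "0 \<le> u * ln (u / v) - u + v" "u * ln (u / v) - u + v \<le> (u - v)\<^sup>2 / v"
proof -
  have "ln (v / u) \<le> v / u - 1" using assms by (intro ln_le_minus_one) simp
  then have "u * ln (v / u) \<le> u * (v / u - 1)" using assms by (intro mult_left_mono) auto
  then show "0 \<le> u * ln (u / v) - u + v"
    using assms by (simp add: ln_div right_diff_distrib)
  have "ln (u / v) \<le> u / v - 1" using assms by (intro ln_le_minus_one) simp
  then have "u * ln (u / v) \<le> u * (u / v - 1)" using assms by (intro mult_left_mono) auto
  also have "\<dots> = (u - v)\<^sup>2 / v + u - v"
    using assms by (simp add: field_simps power2_eq_square)
  finally show "u * ln (u / v) - u + v \<le> (u - v)\<^sup>2 / v" by simp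
qed

text \<open>Because the two functions have the same total mass, \<open>f * ln (f / f')\<close> may be replaced by
  \<open>f * ln (f / f') - f + f'\<close>, which is non-negative, at most \<open>(f - f')\<^sup>2 / f'\<close>, and asymptotically half
  of that.  Multiplied by \<open>n\<close>, it is bounded uniformly and converges pointwise.\<close>

lemma (in finite_measure) scaled_KL_limit:
  fixes f f' :: "nat \<Rightarrow> 'a \<Rightarrow> real"
  assumes [measurable]: "\<And>n. f n \<in> borel_measurable M" "\<And>n. f' n \<in> borel_measurable M"
      "f0 \<in> borel_measurable M"
    and f0: "0 < c" "\<And>x. x \<in> space M \<Longrightarrow> c \<le> f0 x" "\<And>x. x \<in> space M \<Longrightarrow> f0 x \<le> B"
    and bound: "\<forall>\<^sub>F n in sequentially. \<forall>x\<in>space M. \<bar>sqrt (real n) * (f n x - f0 x)\<bar> \<le> H"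
      "\<forall>\<^sub>F n in sequentially. \<forall>x\<in>space M. \<bar>sqrt (real n) * (f' n x - f0 x)\<bar> \<le> H"
    and lim: "\<And>x. x \<in> space M \<Longrightarrow> (\<lambda>n. sqrt (real n) * (f n x - f0 x)) \<longlonglongrightarrow> \<delta> x"
      "\<And>x. x \<in> space M \<Longrightarrow> (\<lambda>n. sqrt (real n) * (f' n x - f0 x)) \<longlonglongrightarrow> \<delta>' x"
    and mass: "\<forall>\<^sub>F n in sequentially. (\<integral>x. f n x \<partial>M) = (\<integral>x. f' n x \<partial>M)"
  shows "(\<lambda>n. real n * (\<integral>x. f n x * ln (f n x / f' n x) \<partial>M))
    \<longlonglongrightarrow> 1 / 2 * (\<integral>x. (\<delta> x - \<delta>' x)\<^sup>2 / f0 x \<partial>M)"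
proof -
  have [measurable]: "\<delta> \<in> borel_measurable M" "\<delta>' \<in> borel_measurable M"
    by (rule borel_measurable_LIMSEQ_real[OF lim(1)], assumption, measurable)
       (rule borel_measurable_LIMSEQ_real[OF lim(2)], assumption, measurable)
  define D where "D = (\<lambda>n x. f n x * ln (f n x / f' n x) - f n x + f' n x)"
  \<comment> \<open>From this size on, \<open>\<bar>f n x - f0 x\<bar> \<le> H / sqrt n \<le> c / 2\<close>, so the densities stay above \<open>c / 2\<close>; the
    added 1 keeps \<open>n\<close> positive when \<open>H = 0\<close>.\<close>
  have "\<forall>\<^sub>F n in sequentially. (2 * \<bar>H\<bar> / c)\<^sup>2 + 1 \<le> real n"
    using filterlim_real_sequentially by (simp add: filterlim_at_top)
  with bound mass have "\<forall>\<^sub>F n in sequentially. (2 * \<bar>H\<bar> / c)\<^sup>2 + 1 \<le> real n \<and>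
      (\<forall>x\<in>space M. \<bar>sqrt (real n) * (f n x - f0 x)\<bar> \<le> H) \<and>
      (\<forall>x\<in>space M. \<bar>sqrt (real n) * (f' n x - f0 x)\<bar> \<le> H) \<and>
      (\<integral>x. f n x \<partial>M) = (\<integral>x. f' n x \<partial>M)"
    by eventually_elim simp
  then obtain N where N: "\<And>n. n \<ge> N \<Longrightarrow> (2 * \<bar>H\<bar> / c)\<^sup>2 + 1 \<le> real n"
     "\<And>n x. n \<ge> N \<Longrightarrow> x \<in> space M \<Longrightarrow> \<bar>sqrt (real n) * (f n x - f0 x)\<bar> \<le> H"
     "\<And>n x. n \<ge> N \<Longrightarrow> x \<in> space M \<Longrightarrow> \<bar>sqrt (real n) * (f' n x - f0 x)\<bar> \<le> H"
     "\<And>n. n \<ge> N \<Longrightarrow> (\<integral>x. f n x \<partial>M) = (\<integral>x. f' n x \<partial>M)"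
    unfolding eventually_sequentially by blast
  have sqrt_n: "0 < sqrt (real n)" "2 * \<bar>H\<bar> \<le> c * sqrt (real n)" if "n \<ge> N" for n
  proof -
    show "0 < sqrt (real n)" using N(1)[OF that] by (smt (verit) zero_le_power2 real_sqrt_gt_zero)
    have "2 * \<bar>H\<bar> / c \<le> sqrt (real n)"
      using N(1)[OF that] by (intro real_le_rsqrt) linarith
    then show "2 * \<bar>H\<bar> \<le> c * sqrt (real n)"
      using f0(1) by (simp add: field_simps)
  qed
  have near: "c / 2 \<le> y \<and> y \<le> B + c / 2"
    if "n \<ge> N" "x \<in> space M" "\<bar>sqrt (real n) * (y - f0 x)\<bar> \<le> H" for n x y
  proof -
    have "sqrt (real n) * \<bar>y - f0 x\<bar> \<le> H"
      using that(3) by (simp add: abs_mult)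
    also have "H \<le> sqrt (real n) * (c / 2)"
      using sqrt_n(2)[OF that(1)] by (simp add: mult.commute)
    finally have "\<bar>y - f0 x\<bar> \<le> c / 2"
      using sqrt_n(1)[OF that(1)] by simp
    then show ?thesis using f0(2,3)[OF that(2)] by linarith
  qed
  have f: "c / 2 \<le> f n x" "f n x \<le> B + c / 2" "c / 2 \<le> f' n x" "f' n x \<le> B + c / 2"
    if "n \<ge> N" "x \<in> space M" for n x
    using near[OF that N(2)[OF that]] near[OF that N(3)[OF that]] by auto
  have D_meas [measurable]: "D n \<in> borel_measurable M" for n
    unfolding D_def by measurable
  have D_bound: "0 \<le> real n * D n x \<and> real n * D n x \<le> 8 * H\<^sup>2 / c"
    if "n \<ge> N" "x \<in> space M" for n x
  proof -
    have pos: "0 < f n x" "0 < f' n x" using f(1,3)[OF that] f0(1) by auto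
    have "\<bar>sqrt (real n) * (f n x - f' n x)\<bar> \<le> 2 * \<bar>H\<bar>"
      using N(2,3)[OF that] by (simp add: algebra_simps)
    then have "(sqrt (real n) * (f n x - f' n x))\<^sup>2 \<le> (2 * \<bar>H\<bar>)\<^sup>2"
      by (metis abs_le_square_iff abs_abs abs_mult abs_numeral)
    then have sq: "real n * (f n x - f' n x)\<^sup>2 \<le> 4 * H\<^sup>2"
      by (simp add: power_mult_distrib)
    have "real n * D n x \<le> real n * ((f n x - f' n x)\<^sup>2 / f' n x)"
      unfolding D_def by (intro mult_left_mono KL_integrand_bounds pos) simp
    also have "\<dots> \<le> (4 * H\<^sup>2) / (c / 2)"
      unfolding times_divide_eq_right using sq f(3)[OF that] f0(1) by (intro frac_le) auto
    finally show ?thesis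
      using KL_integrand_bounds(1)[OF pos] by (auto simp: D_def)
  qed
  have limD: "(\<lambda>n. real n * D n x) \<longlonglongrightarrow> 1 / 2 * ((\<delta> x - \<delta>' x)\<^sup>2 / f0 x)" if x: "x \<in> space M" for x
  proof -
    have f0x: "f0 x \<noteq> 0" using f0(1) f0(2)[OF x] by simp
    have inv: "(\<lambda>n. 1 / sqrt (real n)) \<longlonglongrightarrow> 0"
      by real_asymp
    have to_f0: "g \<longlonglongrightarrow> f0 x" if "(\<lambda>n. sqrt (real n) * (g n - f0 x)) \<longlonglongrightarrow> l" for g l
    proof -
      have "(\<lambda>n. 1 / sqrt (real n) * (sqrt (real n) * (g n - f0 x)) + f0 x) \<longlonglongrightarrow> 0 * l + f0 x"
        by (intro tendsto_intros inv that)
      then have "(\<lambda>n. 1 / sqrt (real n) * (sqrt (real n) * (g n - f0 x)) + f0 x) \<longlonglongrightarrow> f0 x"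
        by simp
      moreover have "\<forall>\<^sub>F n in sequentially.
          1 / sqrt (real n) * (sqrt (real n) * (g n - f0 x)) + f0 x = g n"
        using eventually_gt_at_top[of 0] by eventually_elim simp
      ultimately show ?thesis
        by (rule Lim_transform_eventually)
    qed
    have "(\<lambda>n. f n x / f' n x - 1) \<longlonglongrightarrow> f0 x / f0 x - 1"
      by (intro tendsto_intros to_f0[OF lim(1)[OF x]] to_f0[OF lim(2)[OF x]] f0x)
    then have "(\<lambda>n. f n x / f' n x - 1) \<longlonglongrightarrow> 0" using f0x by simp
    then have ratio: "(\<lambda>n. KL_ratio (f n x / f' n x - 1)) \<longlonglongrightarrow> 1 / 2"
      by (rule filterlim_compose[OF KL_ratio_tendsto])
    have "(\<lambda>n. (sqrt (real n) * (f n x - f0 x) - sqrt (real n) * (f' n x - f0 x))\<^sup>2 / f' n x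
        * KL_ratio (f n x / f' n x - 1)) \<longlonglongrightarrow> (\<delta> x - \<delta>' x)\<^sup>2 / f0 x * (1 / 2)"
      by (intro tendsto_intros lim x ratio to_f0[OF lim(2)[OF x]] f0x)
    moreover have "\<forall>\<^sub>F n in sequentially.
        (sqrt (real n) * (f n x - f0 x) - sqrt (real n) * (f' n x - f0 x))\<^sup>2 / f' n x
        * KL_ratio (f n x / f' n x - 1) = real n * D n x"
      using eventually_ge_at_top[of N]
    proof eventually_elim
      case (elim n)
      have "(sqrt (real n) * (f n x - f0 x) - sqrt (real n) * (f' n x - f0 x))\<^sup>2
          = (sqrt (real n) * (f n x - f' n x))\<^sup>2"
        by (simp add: algebra_simps)
      also have "\<dots> = real n * (f n x - f' n x)\<^sup>2"
        by (simp add: power_mult_distrib)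
      finally show ?case
        using KL_integrand_eq[of "f n x" "f' n x"] f(1,3)[OF elim x] f0(1) by (simp add: D_def)
    qed
    ultimately have "(\<lambda>n. real n * D n x) \<longlonglongrightarrow> (\<delta> x - \<delta>' x)\<^sup>2 / f0 x * (1 / 2)"
      by (rule Lim_transform_eventually)
    then show ?thesis by (simp only: mult.commute)
  qed
  have "(\<lambda>n. \<integral>x. real (n + N) * D (n + N) x \<partial>M) \<longlonglongrightarrow> (\<integral>x. 1 / 2 * ((\<delta> x - \<delta>' x)\<^sup>2 / f0 x) \<partial>M)"
  proof (rule integral_dominated_convergence[where w = "\<lambda>_. 8 * H\<^sup>2 / c"])
    show "AE x in M. (\<lambda>n. real (n + N) * D (n + N) x) \<longlonglongrightarrow> 1 / 2 * ((\<delta> x - \<delta>' x)\<^sup>2 / f0 x)"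
      by (intro AE_I2 LIMSEQ_ignore_initial_segment limD)
    show "AE x in M. norm (real (n + N) * D (n + N) x) \<le> 8 * H\<^sup>2 / c" for n
      using D_bound[of "n + N"] by (intro AE_I2) auto
  qed measurable
  moreover have "(\<integral>x. real n * D n x \<partial>M) = real n * (\<integral>x. f n x * ln (f n x / f' n x) \<partial>M)"
    if n: "n \<ge> N" for n
  proof -
    have int_f: "integrable M (f n)" "integrable M (f' n)"
      using f[OF n] f0(1) by (auto intro!: integrable_const_bound[of _ "B + c / 2"] AE_I2 abs_leI)
        (smt (verit) field_sum_of_halves)+
    have "integrable M (\<lambda>x. real n * D n x)"
      using D_bound[OF n] by (intro integrable_const_bound[of _ "8 * H\<^sup>2 / c"] AE_I2) auto
    then have int_D: "integrable M (D n)"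
      using sqrt_n(1)[OF n] by simp
    have "(\<integral>x. f n x * ln (f n x / f' n x) \<partial>M) = (\<integral>x. D n x + f n x - f' n x \<partial>M)"
      by (simp add: D_def)
    also have "\<dots> = (\<integral>x. D n x \<partial>M)"
      using int_f int_D N(4)[OF n] by simp
    finally show ?thesis by simp
  qed
  ultimately have "(\<lambda>n. real (n + N) * (\<integral>x. f (n + N) x * ln (f (n + N) x / f' (n + N) x) \<partial>M))
      \<longlonglongrightarrow> (\<integral>x. 1 / 2 * ((\<delta> x - \<delta>' x)\<^sup>2 / f0 x) \<partial>M)"
    by (simp only: le_add2)
  then have "(\<lambda>n. real (n + N) * (\<integral>x. f (n + N) x * ln (f (n + N) x / f' (n + N) x) \<partial>M))
      \<longlonglongrightarrow> 1 / 2 * (\<integral>x. (\<delta> x - \<delta>' x)\<^sup>2 / f0 x \<partial>M)"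
    by (simp only: integral_mult_right_zero)
  then show ?thesis
    by (rule LIMSEQ_offset)
qed

section \<open>Tilted marginals\<close>

text \<open>Convexity of \<open>exp\<close>: the slope of a chord through 0 increases with its length.\<close>

lemma exp_slope_mono:
  fixes t T u :: real
  assumes "0 < t" "t \<le> T"
  shows "(exp (t * u) - 1) / t \<le> (exp (T * u) - 1) / T"
proof -
  have "exp ((1 - t / T) *\<^sub>R 0 + (t / T) *\<^sub>R (T * u)) \<le> (1 - t / T) * exp 0 + (t / T) * exp (T * u)"
    using assms by (intro convex_onD[OF exp_convex]) auto
  then have "exp (t * u) - 1 \<le> (t / T) * (exp (T * u) - 1)"
    using assms by (simp add: algebra_simps)
  then have "(exp (t * u) - 1) / t \<le> (t / T) * (exp (T * u) - 1) / t"
    using assms by (intro divide_right_mono) auto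
  then show ?thesis
    using assms by simp
qed

definition exp_slope :: "(real \<Rightarrow> real) \<Rightarrow> nat \<Rightarrow> real \<Rightarrow> real" where
  "exp_slope u n \<mu> = sqrt (real n) * (exp (u \<mu> / sqrt (real n)) - 1)"

context mixture_model
begin

lemma tilt_ok_bounded:
  assumes [measurable]: "u \<in> borel_measurable M" and u: "AE \<mu> in M. \<bar>u \<mu>\<bar> \<le> B" and n: "n \<ge> 1"
  shows "tilt_ok \<Omega> g0 (\<lambda>\<mu>. u \<mu> / sqrt (real n))"
  unfolding tilt_ok_def
proof (rule integrable_const_bound)
  show "AE \<mu> in M. norm (g0 \<mu> * exp (u \<mu> / sqrt (real n))) \<le> D * exp B"
    using u AE_Omega
  proof eventually_elim
    case (elim \<mu>)
    have "u \<mu> / sqrt (real n) \<le> \<bar>u \<mu>\<bar> / 1"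
      using n by (intro frac_le) auto
    then have "exp (u \<mu> / sqrt (real n)) \<le> exp B"
      using elim(1) by simp
    then show ?case
      using g0_pos[OF elim(2)] g0_bounds(2)[OF elim(2)] by (auto simp: abs_mult intro!: mult_mono)
  qed
qed measurable

lemma g0_mult_integrable:
  assumes "integrable M u"
  shows "integrable M (\<lambda>\<mu>. g0 \<mu> * u \<mu>)"
proof (rule Bochner_Integration.integrable_bound)
  show "integrable M (\<lambda>\<mu>. D * u \<mu>)" using assms by simp
  show "AE \<mu> in M. norm (g0 \<mu> * u \<mu>) \<le> norm (D * u \<mu>)"
    using g0_bounds g0_pos D_pos by (auto intro!: AE_I2 mult_right_mono simp: abs_mult abs_of_pos)
  have [measurable]: "u \<in> borel_measurable M" using assms by simp
  show "(\<lambda>\<mu>. g0 \<mu> * u \<mu>) \<in> borel_measurable M" by measurable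
qed

text \<open>For \<open>n \<ge> N\<close>, the slope \<open>exp_slope u n \<mu>\<close> lies between the tangent value \<open>u \<mu>\<close> and
  \<open>exp_slope u N \<mu>\<close>, both integrable against \<open>g0\<close>; so the exponential moment at the single scale
  \<open>N\<close> dominates all the later ones.  The bound \<open>H\<close> depends on the weight \<open>v\<close> only through \<open>B\<close>, which makes
  it uniform over the weights \<open>\<lambda>\<mu>. K \<mu> x\<close>.\<close>

lemma exp_slope_moments:
  assumes u: "integrable M u"
    and ok: "\<forall>\<^sub>F n in sequentially. tilt_ok \<Omega> g0 (\<lambda>\<mu>. u \<mu> / sqrt (real n))"
  obtains N H where "N \<ge> 1"
    and "\<And>n. n \<ge> N \<Longrightarrow> integrable M (\<lambda>\<mu>. g0 \<mu> * exp (u \<mu> / sqrt (real n)))"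
    and "\<And>n v. n \<ge> N \<Longrightarrow> v \<in> borel_measurable M \<Longrightarrow> (\<And>\<mu>. \<mu> \<in> \<Omega> \<Longrightarrow> \<bar>v \<mu>\<bar> \<le> B) \<Longrightarrow>
      \<bar>\<integral>\<mu>. v \<mu> * (g0 \<mu> * exp_slope u n \<mu>) \<partial>M\<bar> \<le> H"
    and "\<And>v. v \<in> borel_measurable M \<Longrightarrow> (\<And>\<mu>. \<mu> \<in> \<Omega> \<Longrightarrow> \<bar>v \<mu>\<bar> \<le> B) \<Longrightarrow>
      (\<lambda>n. \<integral>\<mu>. v \<mu> * (g0 \<mu> * exp_slope u n \<mu>) \<partial>M)
      \<longlonglongrightarrow> (\<integral>\<mu>. v \<mu> * (g0 \<mu> * u \<mu>) \<partial>M)"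
proof -
  have [measurable]: "u \<in> borel_measurable M" using u by simp
  obtain N where N: "N \<ge> 1" "\<And>n. n \<ge> N \<Longrightarrow> integrable M (\<lambda>\<mu>. g0 \<mu> * exp (u \<mu> / sqrt (real n)))"
    using eventually_conj[OF ok eventually_ge_at_top[of "1::nat"]]
    unfolding eventually_sequentially tilt_ok_def by blast
  define G where "G = (\<lambda>\<mu>. \<bar>g0 \<mu> * u \<mu>\<bar> + \<bar>sqrt (real N) * (g0 \<mu> * exp (u \<mu> / sqrt (real N)) - g0 \<mu>)\<bar>)"
  have G_int: "integrable M G"
    unfolding G_def
    by (intro Bochner_Integration.integrable_add integrable_abs integrable_mult_right
        Bochner_Integration.integrable_diff g0_mult_integrable u N(2) g0_integrable) simp
  have [measurable]: "exp_slope u n \<in> borel_measurable M" for n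
    unfolding exp_slope_def by measurable
  have dom: "\<bar>g0 \<mu> * exp_slope u n \<mu>\<bar> \<le> G \<mu>" if n: "n \<ge> N" and \<mu>: "\<mu> \<in> \<Omega>" for n \<mu>
  proof -
    have pos: "0 < sqrt (real n)" "0 < sqrt (real N)" using n N(1) by auto
    have "u \<mu> / sqrt (real n) \<le> exp (u \<mu> / sqrt (real n)) - 1"
      using exp_ge_add_one_self[of "u \<mu> / sqrt (real n)"] by linarith
    then have "sqrt (real n) * (u \<mu> / sqrt (real n)) \<le> exp_slope u n \<mu>"
      unfolding exp_slope_def using pos by (intro mult_left_mono) simp_all
    then have lower: "u \<mu> \<le> exp_slope u n \<mu>" using pos by simp
    have upper: "exp_slope u n \<mu> \<le> exp_slope u N \<mu>"
      using exp_slope_mono[of "1 / sqrt (real n)" "1 / sqrt (real N)" "u \<mu>"] pos n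
      by (simp add: exp_slope_def frac_le mult.commute)
    have "\<bar>exp_slope u n \<mu>\<bar> \<le> \<bar>u \<mu>\<bar> + \<bar>exp_slope u N \<mu>\<bar>"
      using lower upper by linarith
    then have "g0 \<mu> * \<bar>exp_slope u n \<mu>\<bar> \<le> g0 \<mu> * (\<bar>u \<mu>\<bar> + \<bar>exp_slope u N \<mu>\<bar>)"
      using g0_pos[OF \<mu>] by (intro mult_left_mono) auto
    moreover have "\<bar>sqrt (real N) * (g0 \<mu> * exp (u \<mu> / sqrt (real N)) - g0 \<mu>)\<bar> = g0 \<mu> * \<bar>exp_slope u N \<mu>\<bar>"
    proof -
      have "sqrt (real N) * (g0 \<mu> * exp (u \<mu> / sqrt (real N)) - g0 \<mu>) = g0 \<mu> * exp_slope u N \<mu>"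
        by (simp add: exp_slope_def algebra_simps)
      then show ?thesis using g0_pos[OF \<mu>] by (simp add: abs_mult)
    qed
    ultimately show ?thesis
      using g0_pos[OF \<mu>] by (simp add: G_def abs_mult distrib_left)
  qed
  have dom_v: "\<bar>v \<mu> * (g0 \<mu> * exp_slope u n \<mu>)\<bar> \<le> \<bar>B\<bar> * G \<mu>"
    if "n \<ge> N" "\<And>\<mu>. \<mu> \<in> \<Omega> \<Longrightarrow> \<bar>v \<mu>\<bar> \<le> B" "\<mu> \<in> \<Omega>" for n v \<mu>
    unfolding abs_mult[of "v \<mu>"] using dom[OF that(1,3)] that(2)[OF that(3)] by (intro mult_mono) auto
  show thesis
  proof (rule that[OF N])
    fix n v assume n: "n \<ge> N" and [measurable]: "v \<in> borel_measurable M"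
      and v: "\<And>\<mu>. \<mu> \<in> \<Omega> \<Longrightarrow> \<bar>v \<mu>\<bar> \<le> B"
    have "\<bar>\<integral>\<mu>. v \<mu> * (g0 \<mu> * exp_slope u n \<mu>) \<partial>M\<bar> \<le> (\<integral>\<mu>. \<bar>v \<mu> * (g0 \<mu> * exp_slope u n \<mu>)\<bar> \<partial>M)"
      by (rule integral_abs_bound)
    also have "\<dots> \<le> (\<integral>\<mu>. \<bar>B\<bar> * G \<mu> \<partial>M)"
    proof (rule integral_mono)
      show int: "integrable M (\<lambda>\<mu>. \<bar>B\<bar> * G \<mu>)" using G_int by simp
      show "integrable M (\<lambda>\<mu>. \<bar>v \<mu> * (g0 \<mu> * exp_slope u n \<mu>)\<bar>)"
        by (rule Bochner_Integration.integrable_bound[OF int])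
          (auto intro!: AE_I2 order_trans[OF dom_v[OF n v] abs_ge_self])
    qed (auto intro!: dom_v[OF n v])
    finally show "\<bar>\<integral>\<mu>. v \<mu> * (g0 \<mu> * exp_slope u n \<mu>) \<partial>M\<bar>
        \<le> (\<integral>\<mu>. \<bar>B\<bar> * G \<mu> \<partial>M)"
      .
  next
    fix v assume [measurable]: "v \<in> borel_measurable M"
      and v: "\<And>\<mu>. \<mu> \<in> \<Omega> \<Longrightarrow> \<bar>v \<mu>\<bar> \<le> B"
    have "(\<lambda>n. \<integral>\<mu>. v \<mu> * (g0 \<mu> * exp_slope u (n + N) \<mu>) \<partial>M) \<longlonglongrightarrow> (\<integral>\<mu>. v \<mu> * (g0 \<mu> * u \<mu>) \<partial>M)"
    proof (rule integral_dominated_convergence[where w = "\<lambda>\<mu>. \<bar>B\<bar> * G \<mu>"])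
      show "integrable M (\<lambda>\<mu>. \<bar>B\<bar> * G \<mu>)" using G_int by simp
      show "AE \<mu> in M. norm (v \<mu> * (g0 \<mu> * exp_slope u (n + N) \<mu>)) \<le> \<bar>B\<bar> * G \<mu>" for n
        using dom_v[OF _ v, of "n + N"] by (intro AE_I2) simp
      have slope: "(\<lambda>n. sqrt (real n) * (exp (y / sqrt (real n)) - 1)) \<longlonglongrightarrow> y" for y :: real
        by real_asymp
      show "AE \<mu> in M. (\<lambda>n. v \<mu> * (g0 \<mu> * exp_slope u (n + N) \<mu>)) \<longlonglongrightarrow> v \<mu> * (g0 \<mu> * u \<mu>)"
        unfolding exp_slope_def
        by (intro AE_I2 tendsto_mult tendsto_const LIMSEQ_ignore_initial_segment[OF slope])
    qed measurable
    then have "(\<lambda>n. \<integral>\<mu>. v \<mu> * (g0 \<mu> * exp_slope u n \<mu>) \<partial>M) \<longlonglongrightarrow> (\<integral>\<mu>. v \<mu> * (g0 \<mu> * u \<mu>) \<partial>M)"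
      by (rule LIMSEQ_offset)
    then show "(\<lambda>n. \<integral>\<mu>. v \<mu> * (g0 \<mu> * exp_slope u n \<mu>) \<partial>M)
      \<longlonglongrightarrow> (\<integral>\<mu>. v \<mu> * (g0 \<mu> * u \<mu>) \<partial>M)"
      .
  qed
qed

text \<open>With \<open>Z n\<close> the normalising constant, \<open>Z n * f n - Z n * f0\<close> is \<open>1 / sqrt n\<close> times
  \<open>I n - f0 * J n\<close>, where \<open>I n\<close> and \<open>J n\<close> are moments of \<open>exp_slope u n\<close> with weights \<open>\<lambda>\<mu>. K \<mu> x\<close>
  and 1, and \<open>Z n\<close> tends to 1.\<close>

lemma tilted_marginal_expansion:
  assumes u: "integrable M u"
    and ok: "\<forall>\<^sub>F n in sequentially. tilt_ok \<Omega> g0 (\<lambda>\<mu>. u \<mu> / sqrt (real n))"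
  defines "f \<equiv> \<lambda>n. marginal \<Omega> K (local_tilt \<Omega> g0 u n)"
  shows "\<exists>H. \<forall>\<^sub>F n in sequentially. \<forall>x\<in>\<Omega>. \<bar>sqrt (real n) * (f n x - f0 x)\<bar> \<le> H"
    and "x \<in> \<Omega> \<Longrightarrow> (\<lambda>n. sqrt (real n) * (f n x - f0 x))
      \<longlonglongrightarrow> marginal \<Omega> K (\<lambda>\<mu>. g0 \<mu> * u \<mu>) x - f0 x * (\<integral>\<mu>. g0 \<mu> * u \<mu> \<partial>M)"
    and "\<forall>\<^sub>F n in sequentially. (\<integral>x. f n x \<partial>M) = 1"
proof -
  have [measurable]: "u \<in> borel_measurable M" using u by simp
  define I where "I = (\<lambda>n x. marginal \<Omega> K (\<lambda>\<mu>. g0 \<mu> * exp_slope u n \<mu>) x)"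
  define J where "J = (\<lambda>n. \<integral>\<mu>. g0 \<mu> * exp_slope u n \<mu> \<partial>M)"
  define Z where "Z = (\<lambda>n. \<integral>\<mu>. g0 \<mu> * exp (u \<mu> / sqrt (real n)) \<partial>M)"
  obtain N H where N: "N \<ge> 1" "\<And>n. n \<ge> N \<Longrightarrow> integrable M (\<lambda>\<mu>. g0 \<mu> * exp (u \<mu> / sqrt (real n)))"
    and bound: "\<And>n v. n \<ge> N \<Longrightarrow> v \<in> borel_measurable M \<Longrightarrow> (\<And>\<mu>. \<mu> \<in> \<Omega> \<Longrightarrow> \<bar>v \<mu>\<bar> \<le> max 1 D) \<Longrightarrow>
      \<bar>\<integral>\<mu>. v \<mu> * (g0 \<mu> * exp_slope u n \<mu>) \<partial>M\<bar> \<le> H"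
    and lim: "\<And>v. v \<in> borel_measurable M \<Longrightarrow> (\<And>\<mu>. \<mu> \<in> \<Omega> \<Longrightarrow> \<bar>v \<mu>\<bar> \<le> max 1 D) \<Longrightarrow>
      (\<lambda>n. \<integral>\<mu>. v \<mu> * (g0 \<mu> * exp_slope u n \<mu>) \<partial>M) \<longlonglongrightarrow> (\<integral>\<mu>. v \<mu> * (g0 \<mu> * u \<mu>) \<partial>M)"
  proof (rule exp_slope_moments[OF u ok, where B = "max 1 D"], goal_cases)
    case (1 N H)
    show ?case by (rule 1(1)) (fact 1(2-5))+
  qed
  have K_le: "\<bar>K \<mu> x\<bar> \<le> max 1 D" if "\<mu> \<in> \<Omega>" "x \<in> \<Omega>" for \<mu> x
    using K_abs_bound[OF that] by simp
  have I_bound: "\<bar>I n x\<bar> \<le> H" if "n \<ge> N" "x \<in> \<Omega>" for n x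
    unfolding I_def marginal_def by (rule bound) (use that K_le in auto)
  have I_lim: "(\<lambda>n. I n x) \<longlonglongrightarrow> marginal \<Omega> K (\<lambda>\<mu>. g0 \<mu> * u \<mu>) x" if "x \<in> \<Omega>" for x
    unfolding I_def marginal_def by (rule lim) (use that K_le in auto)
  have J_bound: "\<bar>J n\<bar> \<le> H" if "n \<ge> N" for n
    using bound[OF that, of "\<lambda>_. 1"] by (simp add: J_def)
  have J_lim: "J \<longlonglongrightarrow> (\<integral>\<mu>. g0 \<mu> * u \<mu> \<partial>M)"
    using lim[of "\<lambda>_. 1"] by (simp add: J_def[abs_def])
  have q_int: "integrable M (\<lambda>\<mu>. g0 \<mu> * exp_slope u n \<mu>)" if "n \<ge> N" for n
  proof -
    have "integrable M (\<lambda>\<mu>. sqrt (real n) * (g0 \<mu> * exp (u \<mu> / sqrt (real n)) - g0 \<mu>))"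
      by (intro integrable_mult_right Bochner_Integration.integrable_diff N(2) that g0_integrable)
    then show ?thesis by (simp add: exp_slope_def algebra_simps)
  qed
  have tilt_eq: "g0 \<mu> * exp (u \<mu> / sqrt (real n)) = g0 \<mu> + (1 / sqrt (real n)) * (g0 \<mu> * exp_slope u n \<mu>)"
    if "n \<ge> N" for n \<mu>
    using that N(1) by (simp add: exp_slope_def algebra_simps)
  have Z_eq: "Z n = 1 + J n / sqrt (real n)" if n: "n \<ge> N" for n
    unfolding Z_def tilt_eq[OF n] J_def using q_int[OF n] g0_integrable g0_integral by simp
  have "(\<lambda>n. 1 + J n * (1 / sqrt (real n))) \<longlonglongrightarrow> 1 + (\<integral>\<mu>. g0 \<mu> * u \<mu> \<partial>M) * 0"
  proof (intro tendsto_intros J_lim)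
    show "(\<lambda>n. 1 / sqrt (real n)) \<longlonglongrightarrow> 0" by real_asymp
  qed
  moreover have "\<forall>\<^sub>F n in sequentially. 1 + J n * (1 / sqrt (real n)) = Z n"
    using eventually_ge_at_top[of N] by eventually_elim (simp add: Z_eq)
  ultimately have "Z \<longlonglongrightarrow> 1 + (\<integral>\<mu>. g0 \<mu> * u \<mu> \<partial>M) * 0"
    by (rule Lim_transform_eventually)
  then have Z_lim: "Z \<longlonglongrightarrow> 1" by simp
  have Z_half: "\<forall>\<^sub>F n in sequentially. 1 / 2 < Z n"
    by (rule order_tendstoD(1)[OF Z_lim]) simp
  have density: "local_tilt \<Omega> g0 u n = (\<lambda>\<mu>. g0 \<mu> * exp (u \<mu> / sqrt (real n)) / Z n)" if "1 / 2 < Z n" for n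
  proof -
    have "psi \<Omega> g0 (\<lambda>\<nu>. u \<nu> / sqrt (real n)) = ln (Z n)"
      by (simp add: psi_def Z_def)
    then show ?thesis
      using that by (simp add: local_tilt_def exp_diff)
  qed
  have score: "\<forall>\<^sub>F n in sequentially. \<forall>x\<in>\<Omega>. sqrt (real n) * (f n x - f0 x) = (I n x - f0 x * J n) / Z n"
    using Z_half eventually_ge_at_top[of N]
  proof eventually_elim
    case (elim n)
    show ?case
    proof
      fix x assume x: "x \<in> \<Omega>"
      have "f n x = (\<integral>\<mu>. K \<mu> x * (g0 \<mu> * exp (u \<mu> / sqrt (real n))) / Z n \<partial>M)"
        by (simp add: f_def marginal_def density[OF elim(1)])
      also have "\<dots> = (\<integral>\<mu>. K \<mu> x * (g0 \<mu> * exp (u \<mu> / sqrt (real n))) \<partial>M) / Z n"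
        by simp
      also have "(\<integral>\<mu>. K \<mu> x * (g0 \<mu> * exp (u \<mu> / sqrt (real n))) \<partial>M)
          = (\<integral>\<mu>. K \<mu> x * g0 \<mu> + (1 / sqrt (real n)) * (K \<mu> x * (g0 \<mu> * exp_slope u n \<mu>)) \<partial>M)"
        unfolding tilt_eq[OF elim(2)] by (simp add: algebra_simps)
      also have "\<dots> = f0 x + I n x / sqrt (real n)"
        using K_mult_integrable[OF g0_integrable x] K_mult_integrable[OF q_int[OF elim(2)] x]
        by (simp add: I_def marginal_def)
      finally have "f n x = (f0 x + I n x / sqrt (real n)) / Z n" .
      then have Zf: "Z n * f n x = f0 x + I n x / sqrt (real n)"
        using elim(1) by simp
      have "Z n * (sqrt (real n) * (f n x - f0 x)) = sqrt (real n) * (Z n * f n x - Z n * f0 x)"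
        by (simp add: algebra_simps)
      also have "\<dots> = sqrt (real n) * (f0 x + I n x / sqrt (real n) - (1 + J n / sqrt (real n)) * f0 x)"
        unfolding Zf using Z_eq[OF elim(2)] by simp
      also have "\<dots> = I n x - f0 x * J n"
        using elim(2) N(1) by (simp add: field_simps)
      finally show "sqrt (real n) * (f n x - f0 x) = (I n x - f0 x * J n) / Z n"
        using elim(1) by (simp add: eq_divide_eq mult.commute)
    qed
  qed
  have "\<forall>\<^sub>F n in sequentially. \<forall>x\<in>\<Omega>. \<bar>sqrt (real n) * (f n x - f0 x)\<bar> \<le> (H + D * H) / (1 / 2)"
    using score Z_half eventually_ge_at_top[of N]
  proof eventually_elim
    case (elim n)
    show ?case
    proof
      fix x assume x: "x \<in> \<Omega>"
      have "\<bar>f0 x * J n\<bar> \<le> D * H"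
        unfolding abs_mult using f0_bounds(2)[OF x] f0_pos[OF x] J_bound[OF elim(3)] D_pos
        by (intro mult_mono) auto
      then have num: "\<bar>I n x - f0 x * J n\<bar> \<le> H + D * H"
        using I_bound[OF elim(3) x] by linarith
      have "\<bar>(I n x - f0 x * J n) / Z n\<bar> \<le> (H + D * H) / (1 / 2)"
        unfolding abs_divide using num elim(2) by (intro frac_le) auto
      then show "\<bar>sqrt (real n) * (f n x - f0 x)\<bar> \<le> (H + D * H) / (1 / 2)"
        using elim(1) x by simp
    qed
  qed
  then show "\<exists>H. \<forall>\<^sub>F n in sequentially. \<forall>x\<in>\<Omega>. \<bar>sqrt (real n) * (f n x - f0 x)\<bar> \<le> H" ..
  show "(\<lambda>n. sqrt (real n) * (f n x - f0 x))
      \<longlonglongrightarrow> marginal \<Omega> K (\<lambda>\<mu>. g0 \<mu> * u \<mu>) x - f0 x * (\<integral>\<mu>. g0 \<mu> * u \<mu> \<partial>M)" if x: "x \<in> \<Omega>"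
  proof -
    have "(\<lambda>n. (I n x - f0 x * J n) / Z n)
        \<longlonglongrightarrow> (marginal \<Omega> K (\<lambda>\<mu>. g0 \<mu> * u \<mu>) x - f0 x * (\<integral>\<mu>. g0 \<mu> * u \<mu> \<partial>M)) / 1"
      by (intro tendsto_intros I_lim[OF x] J_lim Z_lim) simp
    then have "(\<lambda>n. (I n x - f0 x * J n) / Z n)
        \<longlonglongrightarrow> marginal \<Omega> K (\<lambda>\<mu>. g0 \<mu> * u \<mu>) x - f0 x * (\<integral>\<mu>. g0 \<mu> * u \<mu> \<partial>M)"
      by simp
    moreover have "\<forall>\<^sub>F n in sequentially. (I n x - f0 x * J n) / Z n = sqrt (real n) * (f n x - f0 x)"
      using score x by (auto elim: eventually_mono)
    ultimately show ?thesis
      by (rule Lim_transform_eventually)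
  qed
  show "\<forall>\<^sub>F n in sequentially. (\<integral>x. f n x \<partial>M) = 1"
    using Z_half eventually_ge_at_top[of N]
  proof eventually_elim
    case (elim n)
    have "integrable M (local_tilt \<Omega> g0 u n)"
      using N(2)[OF elim(2)] by (simp add: density[OF elim(1)])
    then have "(\<integral>x. f n x \<partial>M) = (\<integral>\<mu>. local_tilt \<Omega> g0 u n \<mu> \<partial>M)"
      unfolding f_def by (rule marginal_integral(2))
    also have "\<dots> = 1"
      using elim(1) by (simp add: density[OF elim(1)]) (simp add: Z_def)
    finally show ?case .
  qed
qed

text \<open>The tilt \<open>u\<close>, centred under \<open>g0\<close> and multiplied by \<open>s\<close>: the centring is the projection to the
  orthogonal complement of \<open>s\<close>.\<close>

definition score :: "(real \<Rightarrow> real) \<Rightarrow> real \<Rightarrow> real" where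
  "score u \<mu> = s \<mu> * u \<mu> - \<langle>\<lambda>\<nu>. s \<nu> * u \<nu>, s\<rangle> * s \<mu>"

lemma s_mult_L2:
  assumes "u \<in> L2 \<Omega>" shows "(\<lambda>\<mu>. s \<mu> * u \<mu>) \<in> L2 \<Omega>"
proof -
  have [measurable]: "u \<in> borel_measurable M" using assms by (rule L2_measurable)
  have "integrable M (\<lambda>\<mu>. g0 \<mu> * (u \<mu> * u \<mu>))"
    using assms by (intro g0_mult_integrable L2_integrable_mult)
  moreover have "integrable M (\<lambda>\<mu>. (s \<mu> * u \<mu>)\<^sup>2) \<longleftrightarrow> integrable M (\<lambda>\<mu>. g0 \<mu> * (u \<mu> * u \<mu>))"
    using g0_pos by (intro Bochner_Integration.integrable_cong)
      (auto simp: power_mult_distrib less_imp_le power2_eq_square[of "u _"])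
  ultimately show ?thesis
    by (simp add: L2_def)
qed

lemma score_L2: "u \<in> L2 \<Omega> \<Longrightarrow> score u \<in> L2 \<Omega>"
  unfolding score_def[abs_def] by (intro L2_diff s_mult_L2 s_L2)

lemma op_score:
  assumes u: "u \<in> L2 \<Omega>" and x: "x \<in> \<Omega>"
  shows "marginal \<Omega> K (\<lambda>\<mu>. g0 \<mu> * u \<mu>) x - f0 x * (\<integral>\<mu>. g0 \<mu> * u \<mu> \<partial>M) = sqrt (f0 x) * A (score u) x"
proof -
  have sq: "s \<mu> * (s \<mu> * u \<mu>) = g0 \<mu> * u \<mu>" if "\<mu> \<in> \<Omega>" for \<mu>
    using g0_pos[OF that] by (simp flip: mult.assoc)
  have "marginal \<Omega> K (\<lambda>\<mu>. s \<mu> * (s \<mu> * u \<mu>)) x = marginal \<Omega> K (\<lambda>\<mu>. g0 \<mu> * u \<mu>) x"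
    unfolding marginal_def by (intro Bochner_Integration.integral_cong) (simp_all add: sq)
  moreover have "\<langle>\<lambda>\<nu>. s \<nu> * u \<nu>, s\<rangle> = (\<integral>\<mu>. g0 \<mu> * u \<mu> \<partial>M)"
    unfolding inner_L2_def by (intro Bochner_Integration.integral_cong) (simp_all add: sq[symmetric])
  moreover have "A (score u) x = A (\<lambda>\<mu>. s \<mu> * u \<mu>) x - \<langle>\<lambda>\<nu>. s \<nu> * u \<nu>, s\<rangle> * sqrt (f0 x)"
    unfolding score_def[abs_def] op_diff[OF s_mult_L2[OF u] s_L2 x] op_carrier[OF x] ..
  ultimately have "A (score u) x = marginal \<Omega> K (\<lambda>\<mu>. g0 \<mu> * u \<mu>) x / sqrt (f0 x)
      - (\<integral>\<mu>. g0 \<mu> * u \<mu> \<partial>M) * sqrt (f0 x)"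
    by (simp add: op_eq_marginal)
  moreover have "sqrt (f0 x) * sqrt (f0 x) = f0 x"
    using f0_pos[OF x] by simp
  ultimately show ?thesis
    using f0_pos[OF x] by (simp add: right_diff_distrib mult.left_commute[of "sqrt (f0 x)"] del: real_sqrt_mult_self)
qed

text \<open>By \<open>op_score\<close> the first-order change of the tilted marginal is \<open>sqrt f0 * A (score u)\<close>; the factor
  \<open>sqrt f0\<close> cancels the weight \<open>1 / f0\<close> of the chi-squared distance.\<close>

theorem local_KL_limit:
  assumes \<tau>: "\<tau> \<in> L2 \<Omega>" "\<forall>\<^sub>F n in sequentially. tilt_ok \<Omega> g0 (\<lambda>\<mu>. \<tau> \<mu> / sqrt (real n))"
    and \<tau>': "\<tau>' \<in> L2 \<Omega>" "\<forall>\<^sub>F n in sequentially. tilt_ok \<Omega> g0 (\<lambda>\<mu>. \<tau>' \<mu> / sqrt (real n))"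
  defines "w \<equiv> \<lambda>\<mu>. score \<tau> \<mu> - score \<tau>' \<mu>"
  shows "(\<lambda>n. real n * D_KL \<Omega> (marginal \<Omega> K (local_tilt \<Omega> g0 \<tau> n))
                              (marginal \<Omega> K (local_tilt \<Omega> g0 \<tau>' n))) \<longlonglongrightarrow> 1 / 2 * \<langle>A w, A w\<rangle>"
proof -
  note E = tilted_marginal_expansion[OF L2_integrable[OF \<tau>(1)] \<tau>(2)]
  note E' = tilted_marginal_expansion[OF L2_integrable[OF \<tau>'(1)] \<tau>'(2)]
  have [measurable]: "\<tau> \<in> borel_measurable M" "\<tau>' \<in> borel_measurable M"
    using \<tau> \<tau>' by (auto intro: L2_measurable)
  obtain H where H: "\<forall>\<^sub>F n in sequentially. \<forall>x\<in>\<Omega>.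
      \<bar>sqrt (real n) * (marginal \<Omega> K (local_tilt \<Omega> g0 \<tau> n) x - f0 x)\<bar> \<le> H"
    using E(1) by blast
  obtain H' where H': "\<forall>\<^sub>F n in sequentially. \<forall>x\<in>\<Omega>.
      \<bar>sqrt (real n) * (marginal \<Omega> K (local_tilt \<Omega> g0 \<tau>' n) x - f0 x)\<bar> \<le> H'"
    using E'(1) by blast
  have "(\<lambda>n. real n * (\<integral>x. marginal \<Omega> K (local_tilt \<Omega> g0 \<tau> n) x
        * ln (marginal \<Omega> K (local_tilt \<Omega> g0 \<tau> n) x / marginal \<Omega> K (local_tilt \<Omega> g0 \<tau>' n) x) \<partial>M))
      \<longlonglongrightarrow> 1 / 2 * (\<integral>x. (sqrt (f0 x) * A (score \<tau>) x - sqrt (f0 x) * A (score \<tau>') x)\<^sup>2 / f0 x \<partial>M)"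
  proof (rule scaled_KL_limit[OF _ _ _ c_pos])
    show "marginal \<Omega> K (local_tilt \<Omega> g0 \<tau> n) \<in> borel_measurable M"
         "marginal \<Omega> K (local_tilt \<Omega> g0 \<tau>' n) \<in> borel_measurable M" for n
      unfolding local_tilt_def by measurable
    show "f0 \<in> borel_measurable M" by measurable
    show "\<And>x. x \<in> space M \<Longrightarrow> c \<le> f0 x" "\<And>x. x \<in> space M \<Longrightarrow> f0 x \<le> D"
      using f0_bounds by auto
    show "\<forall>\<^sub>F n in sequentially. \<forall>x\<in>space M.
        \<bar>sqrt (real n) * (marginal \<Omega> K (local_tilt \<Omega> g0 \<tau> n) x - f0 x)\<bar> \<le> max H H'"
      using H by eventually_elim auto
    show "\<forall>\<^sub>F n in sequentially. \<forall>x\<in>space M.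
        \<bar>sqrt (real n) * (marginal \<Omega> K (local_tilt \<Omega> g0 \<tau>' n) x - f0 x)\<bar> \<le> max H H'"
      using H' by eventually_elim auto
    show "(\<lambda>n. sqrt (real n) * (marginal \<Omega> K (local_tilt \<Omega> g0 \<tau> n) x - f0 x))
        \<longlonglongrightarrow> sqrt (f0 x) * A (score \<tau>) x" if "x \<in> space M" for x
      using E(2)[of x] op_score[OF \<tau>(1), of x] that by simp
    show "(\<lambda>n. sqrt (real n) * (marginal \<Omega> K (local_tilt \<Omega> g0 \<tau>' n) x - f0 x))
        \<longlonglongrightarrow> sqrt (f0 x) * A (score \<tau>') x" if "x \<in> space M" for x
      using E'(2)[of x] op_score[OF \<tau>'(1), of x] that by simp
    show "\<forall>\<^sub>F n in sequentially. (\<integral>x. marginal \<Omega> K (local_tilt \<Omega> g0 \<tau> n) x \<partial>M)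
        = (\<integral>x. marginal \<Omega> K (local_tilt \<Omega> g0 \<tau>' n) x \<partial>M)"
      using E(3) E'(3) by eventually_elim simp
  qed
  moreover have "(\<integral>x. (sqrt (f0 x) * A (score \<tau>) x - sqrt (f0 x) * A (score \<tau>') x)\<^sup>2 / f0 x \<partial>M) = \<langle>A w, A w\<rangle>"
    unfolding inner_L2_def
  proof (rule Bochner_Integration.integral_cong[OF refl])
    fix x assume "x \<in> space M"
    then have x: "x \<in> \<Omega>" by simp
    have "A w x = A (score \<tau>) x - A (score \<tau>') x"
      using op_diff[OF score_L2[OF \<tau>(1)] score_L2[OF \<tau>'(1)] x, of 1] by (simp add: w_def)
    moreover have "(sqrt (f0 x) * A (score \<tau>) x - sqrt (f0 x) * A (score \<tau>') x)\<^sup>2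
        = f0 x * (A (score \<tau>) x - A (score \<tau>') x)\<^sup>2"
      using f0_pos[OF x] by (simp add: power_mult_distrib flip: right_diff_distrib)
    ultimately show "(sqrt (f0 x) * A (score \<tau>) x - sqrt (f0 x) * A (score \<tau>') x)\<^sup>2 / f0 x = A w x * A w x"
      using f0_pos[OF x] by (simp add: power2_eq_square)
  qed
  ultimately show ?thesis
    by (simp add: D_KL_def)
qed

section \<open>Approximation by the most favorable family\<close>

text \<open>The remainder \<open>r\<close> of \<open>s * \<tau>\<close> after projection to the eigenfunctions \<open>z k\<close>, \<open>k \<in> S\<close>, is almost
  everywhere the difference of the two scores: the term \<open>k = 1\<close> accounts for the centring of \<open>\<tau>\<close>, the
  others for \<open>\<tau>'\<close>, which is already centred as \<open>z k\<close> is orthogonal to \<open>s\<close> for \<open>k \<ge> 2\<close>.\<close>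

theorem favorable_family_approximation:
  assumes compact: "compact_op_L2 \<Omega> P" and listing: "eigen_listing \<Omega> P lam z"
    and \<tau>: "\<tau> \<in> L2 \<Omega>" "(\<integral>\<mu>. (\<tau> \<mu>)\<^sup>2 * g0 \<mu> \<partial>M) \<le> C\<^sup>2"
      "\<forall>\<^sub>F n in sequentially. tilt_ok \<Omega> g0 (\<lambda>\<mu>. \<tau> \<mu> / sqrt (real n))"
  shows "\<exists>(\<gamma> :: nat \<Rightarrow> real) \<tau>'.
      \<tau>' = (\<lambda>\<mu>. \<Sum>j=1..p. \<gamma> j * favorable_stat g0 z j \<mu>) \<and>
      (\<forall>n\<ge>1. tilt_ok \<Omega> g0 (\<lambda>\<mu>. \<tau>' \<mu> / sqrt (real n))) \<and>
      (\<exists>L. (\<lambda>n. real n * D_KL \<Omega> (marginal \<Omega> K (local_tilt \<Omega> g0 \<tau> n))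
                                  (marginal \<Omega> K (local_tilt \<Omega> g0 \<tau>' n))) \<longlonglongrightarrow> L \<and>
           L \<le> 1 / 2 * C\<^sup>2 * lam (p + 2))"
proof -
  define h where "h = (\<lambda>\<mu>. s \<mu> * \<tau> \<mu>)"
  define S where "S = {k \<in> {1..Suc p}. lam k \<noteq> 0}"
  define \<gamma> where "\<gamma> = (\<lambda>j. if lam (Suc j) \<noteq> 0 then \<langle>h, z (Suc j)\<rangle> else 0)"
  define \<tau>' where "\<tau>' = (\<lambda>\<mu>. \<Sum>j=1..p. \<gamma> j * favorable_stat g0 z j \<mu>)"
  define r where "r = (\<lambda>\<mu>. h \<mu> - (\<Sum>k\<in>S. \<langle>h, z k\<rangle> * z k \<mu>))"
  define w where "w = (\<lambda>\<mu>. score \<tau> \<mu> - score \<tau>' \<mu>)"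
  note top = top_eigenpair[OF listing]
  have h: "h \<in> L2 \<Omega>" unfolding h_def by (rule s_mult_L2[OF \<tau>(1)])
  have z: "z k \<in> L2 \<Omega>" "eigenpair_L2 \<Omega> P (lam k) (z k)" if "k \<ge> 1" for k
    using listing that by (auto simp: eigen_listing_def eigenpair_L2_def)
  have S: "finite S" "1 \<in> S" "\<And>k. k \<in> S \<Longrightarrow> k \<ge> 1"
    using top(1) by (auto simp: S_def)

  have [measurable]: "favorable_stat g0 z j \<in> borel_measurable M" for j
    unfolding favorable_stat_def[abs_def] using L2_measurable[OF z(1), of "Suc j"] by measurable
  then have \<tau>'_meas: "\<tau>' \<in> borel_measurable M"
    unfolding \<tau>'_def by measurable
  have "\<exists>B. AE \<mu> in M. \<bar>\<gamma> j * favorable_stat g0 z j \<mu>\<bar> \<le> B" for j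
  proof (cases "lam (Suc j) = 0")
    case False
    obtain B where B: "AE \<mu> in M. \<bar>z (Suc j) \<mu>\<bar> \<le> B"
      using eigenfunction_bounded[OF z(2) False] by auto
    have "AE \<mu> in M. \<bar>\<gamma> j * favorable_stat g0 z j \<mu>\<bar> \<le> \<bar>\<gamma> j\<bar> * (B / sqrt c)"
      using B AE_Omega
    proof eventually_elim
      case (elim \<mu>)
      then show ?case
        using g0_bounds(1)[of \<mu>] c_pos
        by (auto simp: abs_mult favorable_stat_def intro!: mult_left_mono frac_le)
    qed
    then show ?thesis ..
  qed (auto simp: \<gamma>_def intro!: exI[of _ 0])
  then obtain B where B: "\<And>j. AE \<mu> in M. \<bar>\<gamma> j * favorable_stat g0 z j \<mu>\<bar> \<le> B j"
    by metis
  have "AE \<mu> in M. \<forall>j\<in>{1..p}. \<bar>\<gamma> j * favorable_stat g0 z j \<mu>\<bar> \<le> B j"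
    using B by (simp add: AE_ball_countable)
  then have \<tau>'_bound: "AE \<mu> in M. \<bar>\<tau>' \<mu>\<bar> \<le> (\<Sum>j=1..p. B j)"
    unfolding \<tau>'_def by eventually_elim (auto intro!: order_trans[OF sum_abs] sum_mono)
  have \<tau>'_L2: "\<tau>' \<in> L2 \<Omega>"
    by (rule L2_bounded[OF \<tau>'_meas \<tau>'_bound])
  have ok': "\<forall>n\<ge>1. tilt_ok \<Omega> g0 (\<lambda>\<mu>. \<tau>' \<mu> / sqrt (real n))"
    using tilt_ok_bounded[OF \<tau>'_meas \<tau>'_bound] by blast

  have s\<tau>': "s \<mu> * \<tau>' \<mu> = (\<Sum>k\<in>S - {1}. \<langle>h, z k\<rangle> * z k \<mu>)" if "\<mu> \<in> \<Omega>" for \<mu>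
  proof -
    have "s \<mu> * \<tau>' \<mu> = (\<Sum>j=1..p. \<gamma> j * z (Suc j) \<mu>)"
      using g0_pos[OF that] by (simp add: \<tau>'_def favorable_stat_def sum_distrib_left)
    also have "\<dots> = (\<Sum>k=Suc 1..Suc p. if lam k \<noteq> 0 then \<langle>h, z k\<rangle> * z k \<mu> else 0)"
      unfolding sum.shift_bounds_cl_Suc_ivl by (intro sum.cong) (auto simp: \<gamma>_def)
    also have "\<dots> = (\<Sum>k\<in>S - {1}. \<langle>h, z k\<rangle> * z k \<mu>)"
      by (rule sum.mono_neutral_cong_right) (auto simp: S_def)
    finally show ?thesis .
  qed
  have "\<langle>\<lambda>\<mu>. s \<mu> * \<tau>' \<mu>, s\<rangle> = \<langle>\<lambda>\<mu>. \<Sum>k\<in>S - {1}. \<langle>h, z k\<rangle> * z k \<mu>, s\<rangle>"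
    unfolding inner_L2_def[of _ _ s] by (intro Bochner_Integration.integral_cong) (simp_all add: s\<tau>')
  also have "\<dots> = (\<Sum>k\<in>S - {1}. \<langle>h, z k\<rangle> * \<langle>z k, s\<rangle>)"
    using z(1) S(3) s_L2 by (intro inner_sum_left) auto
  also have "\<dots> = 0"
  proof (rule sum.neutral, rule ballI)
    fix k assume "k \<in> S - {1}"
    then have "k \<ge> 2" using S(3)[of k] by force
    then show "\<langle>h, z k\<rangle> * \<langle>z k, s\<rangle> = 0" using top(4) by simp
  qed
  finally have centred: "\<langle>\<lambda>\<mu>. s \<mu> * \<tau>' \<mu>, s\<rangle> = 0" .
  have "\<langle>h, z 1\<rangle> = \<langle>h, \<lambda>\<mu>. \<langle>z 1, s\<rangle> * s \<mu>\<rangle>"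
    using top(3) by (intro inner_cong_AE h z(1) L2_scale s_L2) auto
  then have hz1: "\<langle>h, z 1\<rangle> = \<langle>z 1, s\<rangle> * \<langle>h, s\<rangle>"
    by (simp add: inner_scale_right)
  \<comment> \<open>\<open>z 1\<close> is \<open>s\<close> or \<open>- s\<close>; the sign cancels in the projection \<open>\<langle>h, z 1\<rangle> * z 1 \<mu>\<close>.\<close>
  have w_eq: "AE \<mu> in M. w \<mu> = r \<mu>"
    using top(3) AE_Omega
  proof eventually_elim
    case (elim \<mu>)
    have "\<langle>h, z 1\<rangle> * z 1 \<mu> = \<langle>z 1, s\<rangle>\<^sup>2 * \<langle>h, s\<rangle> * s \<mu>"
      unfolding hz1 elim(1) by (simp add: power2_eq_square)
    then have "\<langle>h, z 1\<rangle> * z 1 \<mu> = \<langle>h, s\<rangle> * s \<mu>"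
      using top(2) by simp
    then show ?case
      unfolding w_def r_def score_def centred s\<tau>'[OF elim(2)] sum.remove[OF S(1,2)]
      by (simp add: h_def)
  qed

  have on: "\<langle>z j, z k\<rangle> = (if j = k then 1 else 0)" if "j \<in> S" "k \<in> S" for j k
    using listing S(3)[OF that(1)] S(3)[OF that(2)] unfolding eigen_listing_def by blast
  note Bessel = Bessel_remainder[OF h S(1) z(1)[OF S(3)] on, folded r_def]
  have w_L2: "w \<in> L2 \<Omega>"
    using L2_diff[OF score_L2[OF \<tau>(1)] score_L2[OF \<tau>'_L2], of 1] by (simp add: w_def)
  have "\<langle>A w, A w\<rangle> = \<langle>A r, A r\<rangle>"
    unfolding inner_L2_def
    by (intro Bochner_Integration.integral_cong) (simp_all add: op_cong_AE[OF w_eq w_L2 Bessel(1)])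
  also have "\<dots> \<le> lam (Suc (Suc p)) * \<langle>r, r\<rangle>"
    by (rule rayleigh_bound[OF compact listing Bessel(1)]) (use Bessel(2) in \<open>auto simp: S_def\<close>)
  also have "\<dots> \<le> lam (Suc (Suc p)) * C\<^sup>2"
  proof (rule mult_left_mono)
    have "\<langle>h, h\<rangle> = (\<integral>\<mu>. (\<tau> \<mu>)\<^sup>2 * g0 \<mu> \<partial>M)"
      unfolding inner_L2_def h_def
    proof (rule Bochner_Integration.integral_cong[OF refl])
      fix \<mu> assume "\<mu> \<in> space M"
      then have "s \<mu> * s \<mu> = g0 \<mu>" using g0_pos[of \<mu>] by simp
      then show "s \<mu> * \<tau> \<mu> * (s \<mu> * \<tau> \<mu>) = (\<tau> \<mu>)\<^sup>2 * g0 \<mu>"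
        by (simp add: power2_eq_square ac_simps)
    qed
    then show "\<langle>r, r\<rangle> \<le> C\<^sup>2" using Bessel(3) \<tau>(2) by simp
  qed (simp add: listed_eigenvalue_nonneg[OF listing])
  finally have bound: "1 / 2 * \<langle>A w, A w\<rangle> \<le> 1 / 2 * C\<^sup>2 * lam (p + 2)"
    by (simp add: mult.commute)
  have "\<forall>\<^sub>F n in sequentially. tilt_ok \<Omega> g0 (\<lambda>\<mu>. \<tau>' \<mu> / sqrt (real n))"
    using ok' unfolding eventually_sequentially by blast
  from local_KL_limit[OF \<tau>(1,3) \<tau>'_L2 this, folded w_def] bound ok'
  show ?thesis
    unfolding \<tau>'_def by blast
qed

end

text \<open>\<open>K\<close> is unconstrained outside \<open>\<Omega> \<times> \<Omega>\<close>, so its measurability is obtained on the restricted space.\<close>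

lemma continuous_kernel_measurable:
  fixes K :: "real \<Rightarrow> real \<Rightarrow> real"
  assumes "\<Omega> \<in> sets lebesgue" "continuous_on (\<Omega> \<times> \<Omega>) (\<lambda>(\<mu>, x). K \<mu> x)"
  shows "(\<lambda>(\<mu>, x). K \<mu> x) \<in> borel_measurable (lebesgue_on \<Omega> \<Otimes>\<^sub>M lebesgue_on \<Omega>)"
proof -
  have [measurable]: "(\<lambda>x. x) \<in> measurable (lebesgue_on \<Omega>) (borel :: real measure)"
    using assms(1) by (intro continuous_imp_measurable_on_sets_lebesgue continuous_on_id)
  have "(\<lambda>(\<mu>, x). (\<mu>, x)) \<in> measurable (lebesgue_on \<Omega> \<Otimes>\<^sub>M lebesgue_on \<Omega>) (borel \<Otimes>\<^sub>M borel)"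
    by measurable
  then have "(\<lambda>p. p) \<in> measurable (lebesgue_on \<Omega> \<Otimes>\<^sub>M lebesgue_on \<Omega>)
      (restrict_space borel (\<Omega> \<times> \<Omega>))"
    by (intro measurable_restrict_space2) (auto simp: space_pair_measure borel_prod id_def)
  from measurable_compose[OF this borel_measurable_continuous_on_restrict[OF assms(2)]]
  show ?thesis .
qed

theorem corollary4:
  fixes a b C :: real
    and \<Omega> :: "real set"
    and g0 \<tau> :: "real \<Rightarrow> real"
    and K :: "real \<Rightarrow> real \<Rightarrow> real"
    and lam :: "nat \<Rightarrow> real"
    and z :: "nat \<Rightarrow> real \<Rightarrow> real"
    and p :: nat
  assumes "a < b" and "\<Omega> = {a..b}"
    and "continuous_on \<Omega> g0"
    and "\<exists>c>0. \<forall>\<mu>\<in>\<Omega>. c \<le> g0 \<mu>"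
    and "(\<integral>\<mu>. g0 \<mu> \<partial>lebesgue_on \<Omega>) = 1"
    and "continuous_on (\<Omega> \<times> \<Omega>) (\<lambda>(\<mu>, x). K \<mu> x)"
    and "\<exists>c>0. \<forall>\<mu>\<in>\<Omega>. \<forall>x\<in>\<Omega>. c \<le> K \<mu> x"
    and "\<forall>\<mu>\<in>\<Omega>. (\<integral>x. K \<mu> x \<partial>lebesgue_on \<Omega>) = 1"
    and "compact_op_L2 \<Omega> (P_op \<Omega> K g0)"
    and "eigen_listing \<Omega> (P_op \<Omega> K g0) lam z"
    and "\<tau> \<in> L2 \<Omega>"
    and "(\<integral>\<mu>. (\<tau> \<mu>)\<^sup>2 * g0 \<mu> \<partial>lebesgue_on \<Omega>) \<le> C\<^sup>2"
    and "\<forall>\<^sub>F n in sequentially. tilt_ok \<Omega> g0 (\<lambda>\<mu>. \<tau> \<mu> / sqrt (real n))"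
    and "p \<ge> 1"
  shows "\<exists>(\<gamma> :: nat \<Rightarrow> real) \<tau>'.
      \<tau>' = (\<lambda>\<mu>. \<Sum>j=1..p. \<gamma> j * favorable_stat g0 z j \<mu>) \<and>
      (\<forall>n\<ge>1. tilt_ok \<Omega> g0 (\<lambda>\<mu>. \<tau>' \<mu> / sqrt (real n))) \<and>
      (\<exists>L. (\<lambda>n. real n * D_KL \<Omega> (marginal \<Omega> K (local_tilt \<Omega> g0 \<tau> n))
                                  (marginal \<Omega> K (local_tilt \<Omega> g0 \<tau>' n))) \<longlonglongrightarrow> L \<and>
           L \<le> 1 / 2 * C\<^sup>2 * lam (p + 2))"
proof -
  have compact: "compact \<Omega>" and lmeas: "\<Omega> \<in> lmeasurable"
    by (simp_all add: assms(2))
  obtain c1 where c1: "c1 > 0" "\<And>\<mu>. \<mu> \<in> \<Omega> \<Longrightarrow> c1 \<le> g0 \<mu>"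
    using assms(4) by blast
  obtain c2 where c2: "c2 > 0" "\<And>\<mu> x. \<mu> \<in> \<Omega> \<Longrightarrow> x \<in> \<Omega> \<Longrightarrow> c2 \<le> K \<mu> x"
    using assms(7) by blast
  have "bounded (g0 ` \<Omega>)"
    by (intro compact_imp_bounded compact_continuous_image assms(3) compact)
  then obtain D1 where D1: "\<And>\<mu>. \<mu> \<in> \<Omega> \<Longrightarrow> \<bar>g0 \<mu>\<bar> \<le> D1"
    by (auto simp: bounded_iff)
  have "bounded ((\<lambda>(\<mu>, x). K \<mu> x) ` (\<Omega> \<times> \<Omega>))"
    by (intro compact_imp_bounded compact_continuous_image assms(6) compact_Times compact)
  then obtain D2 where D2: "\<And>\<mu> x. \<mu> \<in> \<Omega> \<Longrightarrow> x \<in> \<Omega> \<Longrightarrow> \<bar>K \<mu> x\<bar> \<le> D2"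
    by (auto simp: bounded_iff)
  interpret mixture_model \<Omega> g0 K "min c1 c2" "max D1 D2"
  proof
    show "\<Omega> \<in> lmeasurable" by fact
    show "g0 \<in> borel_measurable (lebesgue_on \<Omega>)"
      using assms(3) lmeas by (intro continuous_imp_measurable_on_sets_lebesgue) auto
    show "(\<lambda>(\<mu>, x). K \<mu> x) \<in> borel_measurable (lebesgue_on \<Omega> \<Otimes>\<^sub>M lebesgue_on \<Omega>)"
      using assms(6) lmeas by (intro continuous_kernel_measurable) auto
  qed (use assms(5,8) c1 c2 D1 D2 in \<open>force simp: abs_le_iff min_le_iff_disj le_max_iff_disj\<close>)+
  show ?thesis
    using favorable_family_approximation assms(9-13) unfolding P_op_def by blast
qed

end
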